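(* Let $\lambda$ be a partition of $n$ and let $\mu=(\mu_1,\dots,\mu_k)$ be a sequence of nonnegative integers with sum $n$. The number of semistandard Young tableaux of shape $\lambda$ and weight $\mu$ is equal to the number of Semi-Noncrossing Tableaux of shape $\lambda$ and weight $\mu$.
   Context: A semistandard Young tableau of shape $\lambda$ and weight $\mu$ is a filling of the Young diagram of $\lambda$ with $\mu_i$ entries equal to $i$, weakly increasing along rows and strictly increasing down columns. Let $\lambda'=(\lambda'_1,\lambda'_2,\dots)$ be the conjugate partition of $\lambda$ (the column lengths). Two disjoint finite sets of integers $a=\{a_1<\dots<a_p\}$ and $b=\{b_1<\dots<b_q\}$ with $p\ge q$ are called non-crossing if: (1) for no $1\le i\le q-1$ does $a_i<b_i<a_{i+1}<b_{i+1}$ or $b_i<a_i<b_{i+1}<a_{i+1}$ hold; and (2) if $p>q$, then $a_q<b_q<a_{q+1}$ does not hold. A Non-Crossing Tableau (NCT) of shape $\lambda$ is a set partition of $\{1,\dots,n\}$ into pairwise non-crossing blocks (called parts) of sizes $\lambda'_1,\lambda'_2,\dots$. Divide $\{1,\dots,n\}$ into consecutive segments $B_1,\dots,B_k$ with $|B_i|=\mu_i$, i.e. $B_i=\{\mu_1+\dots+\mu_{i-1}+1,\dots,\mu_1+\dots+\mu_i\}$. Consider all NCT of shape $\lambda$ each of whose parts contains at most one element from each segment $B_i$. Call two of them equivalent if one is obtained from the other by the action of an element of the Young subgroup $S_{B_1}\times\dots\times S_{B_k}\subset S_n$ permuting the elements within the segments. The Semi-Noncrossing Tableaux of shape $\lambda$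 and weight $\mu$ are the equivalence classes. *)

theory Defs
  imports "HOL-Library.Multiset" "HOL-Library.FuncSet" "HOL-Library.Disjoint_Sets"
    "HOL-Combinatorics.Permutations"
begin

definition is_partition_of :: "nat list \<Rightarrow> nat \<Rightarrow> bool" where
  "is_partition_of lam n \<longleftrightarrow>
     sorted_wrt (\<lambda>x y. y \<le> x) lam \<and> 0 \<notin> set lam \<and> sum_list lam = n"

(* Cells are pairs (row, column), both counted from 0. *)
definition young_diagram :: "nat list \<Rightarrow> (nat \<times> nat) set" where
  "young_diagram lam = {(r, c). r < length lam \<and> c < lam ! r}"

definition conjugate_partition :: "nat list \<Rightarrow> nat list" where
  "conjugate_partition lam =
     map (\<lambda>c. card {r. (r, c) \<in> young_diagram lam}) [0..<(if lam = [] then 0 else hd lam)]"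

(* Entries range over 1..k with k = length mu, and mu ! (i - 1) is the i-th component of the
   weight. Fillings are extensional functions on the diagram, so that they can be counted. *)
definition semistandard_tableaux :: "nat list \<Rightarrow> nat list \<Rightarrow> (nat \<times> nat \<Rightarrow> nat) set" where
  "semistandard_tableaux lam mu =
     {T \<in> young_diagram lam \<rightarrow>\<^sub>E {1..length mu}.
        (\<forall>r c. (r, c) \<in> young_diagram lam \<and> (r, Suc c) \<in> young_diagram lam
           \<longrightarrow> T (r, c) \<le> T (r, Suc c)) \<and>
        (\<forall>r c. (r, c) \<in> young_diagram lam \<and> (Suc r, c) \<in> young_diagram lam
           \<longrightarrow> T (r, c) < T (Suc r, c)) \<and>
        (\<forall>i\<in>{1..length mu}. card {x \<in> young_diagram lam. T x = i} = mu ! (i - 1))}"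

(* The i-th smallest element of a finite set, counted from 1; junk unless 1 \<le> i \<le> card A. *)
definition nth_elem :: "'a::linorder set \<Rightarrow> nat \<Rightarrow> 'a" where
  "nth_elem A i = sorted_list_of_set A ! (i - 1)"

(* Meant for disjoint, finite, nonempty a and b with card b \<le> card a. *)
definition noncrossing :: "'a::linorder set \<Rightarrow> 'a set \<Rightarrow> bool" where
  "noncrossing a b \<longleftrightarrow>
     (let p = card a; q = card b in
        (\<forall>i. 1 \<le> i \<and> i < q \<longrightarrow>
           \<not> (nth_elem a i < nth_elem b i \<and> nth_elem b i < nth_elem a (i + 1)
              \<and> nth_elem a (i + 1) < nth_elem b (i + 1)) \<and>
           \<not> (nth_elem b i < nth_elem a i \<and> nth_elem a i < nth_elem b (i + 1)
              \<and> nth_elem b (i + 1) < nth_elem a (i + 1))) \<and>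
        (q < p \<longrightarrow>
           \<not> (nth_elem a q < nth_elem b q \<and> nth_elem b q < nth_elem a (q + 1))))"

definition noncrossing_tableaux :: "nat \<Rightarrow> nat list \<Rightarrow> nat set set set" where
  "noncrossing_tableaux n lam =
     {P. partition_on {1..n} P \<and>
         image_mset card (mset_set P) = mset (conjugate_partition lam) \<and>
         (\<forall>a\<in>P. \<forall>b\<in>P. a \<noteq> b \<and> card b \<le> card a \<longrightarrow> noncrossing a b)}"

(* The i-th segment, for i in 1..k. *)
definition segment :: "nat list \<Rightarrow> nat \<Rightarrow> nat set" where
  "segment mu i = {sum_list (take (i - 1) mu) + 1 .. sum_list (take i mu)}"

definition segment_young_subgroup :: "nat list \<Rightarrow> (nat \<Rightarrow> nat) set" where
  "segment_young_subgroup mu =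
     {\<pi>. \<pi> permutes {1..sum_list mu} \<and> (\<forall>i\<in>{1..length mu}. \<pi> ` segment mu i = segment mu i)}"

definition transversal_nct :: "nat \<Rightarrow> nat list \<Rightarrow> nat list \<Rightarrow> nat set set set" where
  "transversal_nct n lam mu =
     {P \<in> noncrossing_tableaux n lam. \<forall>a\<in>P. \<forall>i\<in>{1..length mu}. card (a \<inter> segment mu i) \<le> 1}"

definition segment_equiv :: "nat \<Rightarrow> nat list \<Rightarrow> nat list \<Rightarrow> (nat set set \<times> nat set set) set" where
  "segment_equiv n lam mu =
     {(P, Q). P \<in> transversal_nct n lam mu \<and> Q \<in> transversal_nct n lam mu \<and>
              (\<exists>\<pi>\<in>segment_young_subgroup mu. Q = (\<lambda>a. \<pi> ` a) ` P)}"

definition semi_noncrossing_tableaux :: "nat \<Rightarrow> nat list \<Rightarrow> nat list \<Rightarrow> nat set set set set" where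
  "semi_noncrossing_tableaux n lam mu = transversal_nct n lam mu // segment_equiv n lam mu"

lemma equiv_segment_equiv: "equiv (transversal_nct n lam mu) (segment_equiv n lam mu)"
proof (rule equivI)
  show "segment_equiv n lam mu \<subseteq> transversal_nct n lam mu \<times> transversal_nct n lam mu"
    by (auto simp: segment_equiv_def)
  have "id \<in> segment_young_subgroup mu"
    by (simp add: segment_young_subgroup_def permutes_id)
  then show "refl_on (transversal_nct n lam mu) (segment_equiv n lam mu)"
    by (auto simp: refl_on_def segment_equiv_def intro!: bexI [of _ id])
  show "sym (segment_equiv n lam mu)"
  proof (rule symI)
    fix P Q assume PQ: "(P, Q) \<in> segment_equiv n lam mu"
    then obtain \<pi> where p: "\<pi> \<in> segment_young_subgroup mu" and Q: "Q = (\<lambda>a. \<pi> ` a) ` P"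
      by (auto simp: segment_equiv_def)
    from p have b: "bij \<pi>" by (auto simp: segment_young_subgroup_def permutes_bij)
    have "inv \<pi> ` segment mu i = segment mu i" if "i \<in> {1..length mu}" for i
    proof -
      from p that have "\<pi> ` segment mu i = segment mu i"
        by (simp add: segment_young_subgroup_def)
      then show ?thesis using image_inv_f_f [OF bij_is_inj [OF b], of "segment mu i"] by simp
    qed
    with p have "inv \<pi> \<in> segment_young_subgroup mu"
      by (simp add: segment_young_subgroup_def permutes_inv)
    moreover have "P = (\<lambda>a. inv \<pi> ` a) ` Q"
      using b by (simp add: Q image_image bij_is_inj)
    ultimately show "(Q, P) \<in> segment_equiv n lam mu"
      using PQ by (auto simp: segment_equiv_def)
  qed
  show "trans (segment_equiv n lam mu)"
  proof (rule transI)
    fix P Q R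
    assume PQ: "(P, Q) \<in> segment_equiv n lam mu" and QR: "(Q, R) \<in> segment_equiv n lam mu"
    then obtain \<pi> \<rho> where p: "\<pi> \<in> segment_young_subgroup mu" "Q = (\<lambda>a. \<pi> ` a) ` P"
      and r: "\<rho> \<in> segment_young_subgroup mu" "R = (\<lambda>a. \<rho> ` a) ` Q"
      by (auto simp: segment_equiv_def)
    have "(\<rho> \<circ> \<pi>) ` segment mu i = segment mu i" if "i \<in> {1..length mu}" for i
    proof -
      have "(\<rho> \<circ> \<pi>) ` segment mu i = \<rho> ` (\<pi> ` segment mu i)" by (rule image_comp [symmetric])
      with p(1) r(1) that show ?thesis by (simp add: segment_young_subgroup_def)
    qed
    with p(1) r(1) have "\<rho> \<circ> \<pi> \<in> segment_young_subgroup mu"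
      by (simp add: segment_young_subgroup_def permutes_compose)
    moreover have "R = (\<lambda>a. (\<rho> \<circ> \<pi>) ` a) ` P"
      by (simp add: p(2) r(2) image_image)
    ultimately have "\<exists>\<sigma>\<in>segment_young_subgroup mu. R = (\<lambda>a. \<sigma> ` a) ` P"
      by (intro bexI [of _ "\<rho> \<circ> \<pi>"])
    moreover have "P \<in> transversal_nct n lam mu" "R \<in> transversal_nct n lam mu"
      using PQ QR by (simp_all add: segment_equiv_def)
    ultimately show "(P, R) \<in> segment_equiv n lam mu"
      by (simp add: segment_equiv_def)
  qed
qed

lemma finite_semistandard_tableaux: "finite (semistandard_tableaux lam mu)"
proof -
  have "young_diagram lam = (SIGMA r:{..<length lam}. {..<lam ! r})"
    by (auto simp: young_diagram_def)
  then have "finite (young_diagram lam)" by simp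
  then have "finite (young_diagram lam \<rightarrow>\<^sub>E {1..length mu})" by (intro finite_PiE) auto
  then show ?thesis by (rule rev_finite_subset) (auto simp: semistandard_tableaux_def)
qed

lemma finite_semi_noncrossing_tableaux: "finite (semi_noncrossing_tableaux n lam mu)"
proof -
  have "transversal_nct n lam mu \<subseteq> Pow (Pow {1..n})"
    by (auto simp: transversal_nct_def noncrossing_tableaux_def partition_on_def)
  then have "finite (transversal_nct n lam mu)" by (rule finite_subset) simp
  moreover have "segment_equiv n lam mu \<subseteq> transversal_nct n lam mu \<times> transversal_nct n lam mu"
    by (auto simp: segment_equiv_def)
  ultimately show ?thesis
    unfolding semi_noncrossing_tableaux_def by (rule finite_quotient)
qed

end

(* Call the rank of an element in its block its level. A non-crossing tableau is the same as its
   level function together with, for each i, an injection from level i + 1 into level i that goes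
   to the left and is non-crossing, with no unmatched element of level i under an arc. As in
   parenthesis matching, such an injection exists as soon as there is any injection going left, and
   it is unique. Sending the c-th element of level r to the cell (r, c) and filling this cell with
   the segment of the element gives a semistandard tableau. In a tableau transversal to the
   segments, an element of level i + 1 precedes all elements of level i in its segment, since
   otherwise some arc would stay inside the segment. Hence the order between adjacent levels is
   determined by the segments, and by uniqueness of the matching the filling determines the
   equivalence class. Conversely, a standardization of a semistandard tableau provides levels that
   admit a matching. *)
theory Submission
  imports Defs "HOL-Library.Product_Lexorder"
begin

subsection \<open>Ranks in finite linearly ordered sets\<close>

text \<open>Ranks count from 0, like the rows and columns of cells, whereas \<open>nth_elem\<close>
  counts from 1; hence the \<open>Suc\<close> in the lemmas relating the two.\<close>

definition rank :: "'a::linorder set \<Rightarrow> 'a \<Rightarrow> nat" where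
  "rank A x = card {y \<in> A. y < x}"

lemma rank_less_iff:
  assumes "finite A" "x \<in> A" "y \<in> A"
  shows "rank A x < rank A y \<longleftrightarrow> x < y"
proof -
  have lt: "rank A u < rank A v" if "u < v" "u \<in> A" for u v
    unfolding rank_def using that assms(1) by (intro psubset_card_mono) auto
  show ?thesis
    using lt [of x y] lt [of y x] assms by (cases x y rule: linorder_cases) auto
qed

lemma rank_eq_iff:
  assumes "finite A" "x \<in> A" "y \<in> A"
  shows "rank A x = rank A y \<longleftrightarrow> x = y"
  using rank_less_iff [OF assms] rank_less_iff [OF assms(1,3,2)] by (metis linorder_neqE less_irrefl)

lemma rank_less_card: "finite A \<Longrightarrow> x \<in> A \<Longrightarrow> rank A x < card A"
  unfolding rank_def by (intro psubset_card_mono) auto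

lemma bij_betw_rank:
  assumes "finite A"
  shows "bij_betw (rank A) A {..<card A}"
proof -
  have inj: "inj_on (rank A) A"
    using assms by (auto simp: inj_on_def rank_eq_iff)
  moreover have "rank A ` A = {..<card A}"
    using assms inj by (intro card_subset_eq) (auto simp: rank_less_card card_image)
  ultimately show ?thesis by (simp add: bij_betw_def)
qed

text \<open>A down-closed subset of \<open>A\<close> is an initial piece of it, so it occupies
  exactly the lowest ranks. This will turn statements about single entries of a tableau into
  counting.\<close>

lemma rank_less_card_downset:
  assumes "finite A" "U \<subseteq> A" "x \<in> A" and down: "\<And>y z. z \<in> U \<Longrightarrow> y \<in> A \<Longrightarrow> y < z \<Longrightarrow> y \<in> U"
  shows "rank A x < card U \<longleftrightarrow> x \<in> U"
proof
  assume "x \<in> U"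
  then show "rank A x < card U"
    unfolding rank_def using assms by (intro psubset_card_mono) (auto intro: finite_subset)
next
  assume "rank A x < card U"
  moreover have "card U \<le> rank A x" if "x \<notin> U"
    unfolding rank_def using assms that
    by (intro card_mono) (auto, metis linorder_neqE)
  ultimately show "x \<in> U" by fastforce
qed

lemma rank_nth_elem:
  assumes "finite A" "i < card A"
  shows "nth_elem A (Suc i) \<in> A" "rank A (nth_elem A (Suc i)) = i"
proof -
  let ?xs = "sorted_list_of_set A"
  have len: "length ?xs = card A" and set: "set ?xs = A" and d: "distinct ?xs"
    using assms by auto
  have sorted: "?xs ! j < ?xs ! l" if "j < l" "l < card A" for j l
    using that len strict_sorted_list_of_set [of A] by (simp add: sorted_wrt_nth_less)
  show "nth_elem A (Suc i) \<in> A"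
    using assms len set unfolding nth_elem_def by (metis diff_Suc_1 nth_mem)
  have "{y \<in> A. y < ?xs ! i} = (!) ?xs ` {..<i}"
  proof (intro equalityI subsetI)
    fix y assume y: "y \<in> {y \<in> A. y < ?xs ! i}"
    then obtain j where j: "j < card A" "y = ?xs ! j"
      using set len by (metis (no_types, lifting) in_set_conv_nth mem_Collect_eq)
    then have "\<not> i \<le> j" using y sorted [of i j] by (cases "i = j") auto
    then show "y \<in> (!) ?xs ` {..<i}" using j by auto
  next
    fix y assume "y \<in> (!) ?xs ` {..<i}"
    then obtain j where "j < i" "y = ?xs ! j" by auto
    then show "y \<in> {y \<in> A. y < ?xs ! i}"
      using sorted [of j i] assms(2) nth_mem [of j ?xs] unfolding set len by auto
  qed
  moreover have "inj_on ((!) ?xs) {..<i}"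
    using d len assms by (auto simp: inj_on_def nth_eq_iff_index_eq)
  ultimately show "rank A (nth_elem A (Suc i)) = i"
    by (simp add: rank_def nth_elem_def card_image)
qed

lemma nth_elem_rank:
  assumes "finite A" "x \<in> A"
  shows "nth_elem A (Suc (rank A x)) = x"
  using rank_nth_elem [OF assms(1) rank_less_card [OF assms]] rank_eq_iff [OF assms(1)] assms(2)
  by blast

subsection \<open>Levels in a partition\<close>

definition block :: "'a set set \<Rightarrow> 'a \<Rightarrow> 'a set" where
  "block P x = (THE a. a \<in> P \<and> x \<in> a)"

definition level :: "'a::linorder set set \<Rightarrow> 'a \<Rightarrow> nat" where
  "level P x = rank (block P x) x"

(* Junk if x is the least element of its block. *)
definition prev :: "'a::linorder set set \<Rightarrow> 'a \<Rightarrow> 'a" where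
  "prev P x = (THE y. y \<in> block P x \<and> Suc (level P y) = level P x)"

locale finite_partition =
  fixes A :: "'a::linorder set" and P :: "'a set set"
  assumes partition: "partition_on A P" and finite_A: "finite A"
begin

lemma block_eq: "a \<in> P \<Longrightarrow> x \<in> a \<Longrightarrow> block P x = a"
  unfolding block_def using partition by (intro the_equality) (auto simp: partition_on_def disjoint_def)

lemma block_in: "x \<in> A \<Longrightarrow> block P x \<in> P"
  using partition block_eq by (auto simp: partition_on_def)

lemma mem_block: "x \<in> A \<Longrightarrow> x \<in> block P x"
  using partition block_eq by (auto simp: partition_on_def)

lemma part_subset: "a \<in> P \<Longrightarrow> a \<subseteq> A"
  using partition by (auto simp: partition_on_def)

lemma finite_part: "a \<in> P \<Longrightarrow> finite a"
  using part_subset finite_A finite_subset by blast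

lemma mem_block_iff: "x \<in> A \<Longrightarrow> y \<in> block P x \<longleftrightarrow> y \<in> A \<and> block P y = block P x"
  using block_in block_eq mem_block part_subset by (metis subsetD)

lemma partition_eq_blocks: "P = block P ` A"
proof (intro equalityI subsetI)
  fix a assume a: "a \<in> P"
  then have "a \<noteq> {}" using partition by (auto simp: partition_on_def)
  then obtain x where "x \<in> a" by blast
  then show "a \<in> block P ` A" using a block_eq part_subset by blast
qed (auto simp: block_in)

lemma level_eq: "a \<in> P \<Longrightarrow> x \<in> a \<Longrightarrow> level P x = rank a x"
  by (simp add: level_def block_eq)

lemma level_less_iff:
  "x \<in> A \<Longrightarrow> y \<in> A \<Longrightarrow> block P x = block P y \<Longrightarrow> level P x < level P y \<longleftrightarrow> x < y"
  unfolding level_def using rank_less_iff [of "block P y" x y] mem_block finite_part block_in by metis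

lemma level_eq_iff:
  "x \<in> A \<Longrightarrow> y \<in> A \<Longrightarrow> block P x = block P y \<Longrightarrow> level P x = level P y \<longleftrightarrow> x = y"
  using level_less_iff [of x y] level_less_iff [of y x] by (metis linorder_neqE less_irrefl)

lemma level_less_card: "x \<in> A \<Longrightarrow> level P x < card (block P x)"
  by (simp add: level_def rank_less_card finite_part block_in mem_block)

lemma ex_level:
  assumes "a \<in> P" "i < card a"
  shows "\<exists>x\<in>a. level P x = i"
proof -
  have "i \<in> rank a ` a"
    using bij_betw_rank [OF finite_part [OF assms(1)]] assms(2) by (auto simp: bij_betw_def)
  then show ?thesis using level_eq [OF assms(1)] by auto
qed

lemma prev_eqI:
  assumes "x \<in> A" "y \<in> A" "block P y = block P x" "Suc (level P y) = level P x"
  shows "prev P x = y"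
  unfolding prev_def
proof (rule the_equality)
  show "y \<in> block P x \<and> Suc (level P y) = level P x" using assms by (simp add: mem_block_iff)
  fix z assume "z \<in> block P x \<and> Suc (level P z) = level P x"
  then show "z = y" using assms level_eq_iff [of z y] by (simp add: mem_block_iff)
qed

lemma
  assumes "x \<in> A" "0 < level P x"
  shows prev_in: "prev P x \<in> A" and block_prev: "block P (prev P x) = block P x"
    and level_prev: "Suc (level P (prev P x)) = level P x" and prev_less: "prev P x < x"
proof -
  have "level P x - 1 < card (block P x)" using level_less_card [OF assms(1)] by simp
  then obtain y where "y \<in> block P x" "level P y = level P x - 1"
    using ex_level block_in assms(1) by blast
  then have y: "y \<in> A" "block P y = block P x" "Suc (level P y) = level P x"
    using assms by (simp_all add: mem_block_iff)
  have eq: "prev P x = y" using prev_eqI [OF assms(1) y] .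
  show "prev P x \<in> A" "block P (prev P x) = block P x" "Suc (level P (prev P x)) = level P x"
    using y eq by simp_all
  show "prev P x < x" using level_less_iff [of y x] y eq assms(1) by simp
qed

text \<open>No level lies strictly between those of \<open>prev P x\<close> and \<open>x\<close>, so
  \<open>prev P x\<close> is the immediate predecessor of \<open>x\<close> in its block.\<close>

lemma le_prev:
  assumes "x \<in> A" "y \<in> A" "block P y = block P x" "y < x"
  shows "0 < level P x" "y \<le> prev P x"
proof -
  show pos: "0 < level P x" using level_less_iff [of y x] assms by simp
  have "\<not> level P (prev P x) < level P y"
    using level_prev [OF assms(1) pos] level_less_iff [of y x] assms by simp
  then show "y \<le> prev P x"
    using level_less_iff [of "prev P x" y] prev_in [OF assms(1) pos] block_prev [OF assms(1) pos] assms
    by simp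
qed

text \<open>The block and the level of \<open>x\<close> can be read off from
  \<open>prev P x\<close>, and together they determine \<open>x\<close>.\<close>

lemma inj_on_prev: "inj_on (prev P) {x \<in> A. 0 < level P x}"
proof (rule inj_onI)
  fix x y assume xy: "x \<in> {x \<in> A. 0 < level P x}" "y \<in> {x \<in> A. 0 < level P x}" "prev P x = prev P y"
  then have "block P x = block P y" "level P x = level P y"
    using block_prev level_prev by (metis mem_Collect_eq)+
  then show "x = y" using level_eq_iff xy by simp
qed

text \<open>Following \<open>prev\<close> for \<open>level P x\<close> steps ends at the least
  element of the block, its only element of level 0. So levels and \<open>prev\<close> alone
  determine the blocks.\<close>

lemma block_eq_iff_root:
  assumes "x \<in> A" "y \<in> A"
  shows "block P x = block P y \<longleftrightarrow> (prev P ^^ level P x) x = (prev P ^^ level P y) y"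
proof -
  have root: "(prev P ^^ level P x) x \<in> A \<and> level P ((prev P ^^ level P x) x) = 0
      \<and> block P ((prev P ^^ level P x) x) = block P x" if "x \<in> A" for x
    using that
  proof (induction "level P x" arbitrary: x)
    case 0 then show ?case by simp
  next
    case (Suc l)
    then have pos: "0 < level P x" by simp
    have "l = level P (prev P x)" using level_prev [OF Suc.prems pos] Suc.hyps by simp
    moreover have "(prev P ^^ level P x) x = (prev P ^^ l) (prev P x)"
      using Suc.hyps(2) by (simp add: funpow_Suc_right del: funpow.simps flip: Suc.hyps(2))
    ultimately show ?case
      using Suc.hyps(1) [of "prev P x"] prev_in [OF Suc.prems pos] block_prev [OF Suc.prems pos] by simp
  qed
  show ?thesis using root [OF assms(1)] root [OF assms(2)] level_eq_iff by metis
qed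

end

subsection \<open>Non-crossing matchings between levels\<close>

text \<open>An arc joins \<open>x\<close> to \<open>g x\<close>, one level down on its left; the
  values at level 0 are arbitrary. The last conjunct expresses non-crossing and the absence of
  unmatched elements under an arc at once: every element of the lower level under an arc starts an
  arc that ends inside.\<close>

definition nc_matching :: "'a::linorder set \<Rightarrow> ('a \<Rightarrow> nat) \<Rightarrow> ('a \<Rightarrow> 'a) \<Rightarrow> bool" where
  "nc_matching A lev g \<longleftrightarrow>
     (\<forall>x\<in>A. 0 < lev x \<longrightarrow> g x \<in> A \<and> Suc (lev (g x)) = lev x \<and> g x < x) \<and>
     inj_on g {x \<in> A. 0 < lev x} \<and>
     (\<forall>x\<in>A. \<forall>y\<in>A. Suc (lev y) = lev x \<and> g x < y \<and> y < x \<longrightarrow>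
        (\<exists>z\<in>A. 0 < lev z \<and> g z = y \<and> z < x))"

lemma nc_matchingD:
  assumes "nc_matching A lev g" "x \<in> A" "y \<in> A" "Suc (lev y) = lev x" "g x < y" "y < x"
  obtains z where "z \<in> A" "0 < lev z" "g z = y" "z < x"
  using assms unfolding nc_matching_def by blast

(* Condition (2) says that under an arc from level i - 1 to level i no element of level i - 1 is
   the last one of its block; together with condition (1) this makes every such element
   the start of an arc nested inside. *)
lemma (in finite_partition) noncrossing_iff_nc_matching:
  "(\<forall>a\<in>P. \<forall>b\<in>P. a \<noteq> b \<and> card b \<le> card a \<longrightarrow> noncrossing a b) \<longleftrightarrow> nc_matching A (level P) (prev P)"
proof
  assume nc: "\<forall>a\<in>P. \<forall>b\<in>P. a \<noteq> b \<and> card b \<le> card a \<longrightarrow> noncrossing a b"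
  have "\<exists>z\<in>A. 0 < level P z \<and> prev P z = y \<and> z < x"
    if x: "x \<in> A" and y: "y \<in> A" and lev: "Suc (level P y) = level P x"
      and less: "prev P x < y" "y < x" for x y
  proof -
    define a b w i where "a = block P x" "b = block P y" "w = prev P x" "i = Suc (level P y)"
    note d = this
    have pos: "0 < level P x" using lev by simp
    have ab: "a \<in> P" "b \<in> P" "x \<in> a" "y \<in> b" using x y d block_in mem_block by auto
    have w: "w \<in> a" "level P w = level P y" "w < x"
      using prev_in [OF x pos] block_prev [OF x pos] level_prev [OF x pos] prev_less [OF x pos] lev d
        mem_block [of w] by auto
    have nth: "nth_elem a i = w" "nth_elem b i = y" "nth_elem a (i + 1) = x"
      using nth_elem_rank [OF finite_part] level_eq ab w lev d by (metis Suc_eq_plus1)+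
    have "a \<noteq> b"
      using w less level_eq_iff [of w y] ab part_subset block_eq d by (metis less_irrefl subsetD)
    then have disj: "a \<inter> b = {}" using ab partition by (auto simp: partition_on_def disjoint_def)
    have i: "1 \<le> i" "i < card a" "i \<le> card b"
      using level_less_card [OF x] level_less_card [OF y] lev d by auto
    \<comment> \<open>The larger block comes first in \<open>noncrossing\<close>, hence two cases.
      If \<open>b\<close> is not larger, condition (2) excludes that \<open>y\<close> is its last
      element; if it is larger, it has a next element because \<open>i < card a\<close>. Condition
      (1) then puts this next element before \<open>x\<close>.\<close>
    have ib: "i < card b \<and> nth_elem b (i + 1) < x"
    proof (cases "card b \<le> card a")
      case True
      then have n: "noncrossing a b" using nc ab \<open>a \<noteq> b\<close> by simp
      have "i \<noteq> card b"
        using n i nth less d unfolding noncrossing_def Let_def by metis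
      then have ib: "i < card b" using i by simp
      have "\<not> x < nth_elem b (i + 1)"
        using n i ib nth less d unfolding noncrossing_def Let_def by metis
      moreover have "nth_elem b (i + 1) \<in> b"
        using rank_nth_elem(1) [OF finite_part ib] ab by simp
      ultimately show ?thesis using disj ab ib by (metis IntI empty_iff linorder_neqE)
    next
      case False
      then have n: "noncrossing b a" using nc ab \<open>a \<noteq> b\<close> by simp
      have ib: "i < card b" using False i by simp
      have "\<not> x < nth_elem b (i + 1)"
        using n i ib nth less d unfolding noncrossing_def Let_def by metis
      moreover have "nth_elem b (i + 1) \<in> b"
        using rank_nth_elem(1) [OF finite_part ib] ab by simp
      ultimately show ?thesis using disj ab ib by (metis IntI empty_iff linorder_neqE)
    qed
    define z where "z = nth_elem b (i + 1)"
    have z: "z \<in> b" "rank b z = i" "z < x"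
      using rank_nth_elem [OF finite_part, of b i] ab ib by (auto simp: z_def)
    then have "level P z = i" "block P z = b" "z \<in> A"
      using level_eq [of b z] block_eq [of b z] ab part_subset [of b] by auto
    then have "prev P z = y" using prev_eqI [of z y] y d by simp
    then show ?thesis using z \<open>level P z = i\<close> \<open>z \<in> A\<close> i by (intro bexI [of _ z]) auto
  qed
  then show "nc_matching A (level P) (prev P)"
    unfolding nc_matching_def using prev_in level_prev prev_less inj_on_prev by simp
next
  assume m: "nc_matching A (level P) (prev P)"
  \<comment> \<open>The sizes of \<open>a\<close> and \<open>b\<close> are not compared, so the
    claim serves for both alternations of condition (1), by exchanging the blocks, and for condition
    (2), where \<open>i = card b\<close> yields the absurd \<open>card b < card b\<close>.\<close>
  have nested: "i < card b \<and> nth_elem b (i + 1) < nth_elem a (i + 1)"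
    if ab: "a \<in> P" "b \<in> P" and i: "1 \<le> i" "i < card a" "i \<le> card b"
      and less: "nth_elem a i < nth_elem b i" "nth_elem b i < nth_elem a (i + 1)" for a b i
  proof -
    define j w x y where "j = i - 1" "w = nth_elem a i" "x = nth_elem a (i + 1)" "y = nth_elem b i"
    note d = this
    have ij: "i = Suc j" using i d by simp
    have w: "w \<in> a" "rank a w = j"
      using rank_nth_elem [OF finite_part [OF ab(1)], of j] i unfolding d(2) ij by simp_all
    have x: "x \<in> a" "rank a x = i"
      using rank_nth_elem [OF finite_part [OF ab(1)], of i] i unfolding d(3) by simp_all
    have y: "y \<in> b" "rank b y = j"
      using rank_nth_elem [OF finite_part [OF ab(2)], of j] i unfolding d(4) ij by simp_all
    have A: "w \<in> A" "x \<in> A" "y \<in> A" using w x y ab part_subset by blast+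
    have L: "level P w = j" "level P x = i" "level P y = j"
      using w x y level_eq [OF ab(1)] level_eq [OF ab(2)] by auto
    have B: "block P w = a" "block P x = a" "block P y = b"
      using w x y block_eq [OF ab(1)] block_eq [OF ab(2)] by auto
    have "prev P x = w" using prev_eqI [of x w] A L B ij by simp
    moreover have "w < y" "y < x" using less by (simp_all add: d)
    ultimately obtain z where z: "z \<in> A" "0 < level P z" "prev P z = y" "z < x"
      using nc_matchingD [OF m A(2,3)] L ij by auto
    then have "level P z = i" "block P z = b"
      using level_prev [OF z(1,2)] block_prev [OF z(1,2)] L B ij by auto
    then have "rank b z = i" "z \<in> b" using level_eq [of b z] mem_block [OF z(1)] ab by auto
    then show ?thesis
      using nth_elem_rank [OF finite_part [OF ab(2)], of z] rank_less_card [OF finite_part [OF ab(2)], of z]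
        z d by auto
  qed
  show "\<forall>a\<in>P. \<forall>b\<in>P. a \<noteq> b \<and> card b \<le> card a \<longrightarrow> noncrossing a b"
  proof (intro ballI impI)
    fix a b assume ab: "a \<in> P" "b \<in> P" and le: "a \<noteq> b \<and> card b \<le> card a"
    have pos: "1 \<le> card b"
      using ab finite_part partition by (metis One_nat_def Suc_leI card_gt_0_iff partition_on_def)
    show "noncrossing a b"
      unfolding noncrossing_def Let_def
    proof (intro conjI allI impI)
      fix i assume i: "1 \<le> i \<and> i < card b"
      show "\<not> (nth_elem a i < nth_elem b i \<and> nth_elem b i < nth_elem a (i + 1)
              \<and> nth_elem a (i + 1) < nth_elem b (i + 1))"
        using nested [OF ab, of i] i le by auto
      show "\<not> (nth_elem b i < nth_elem a i \<and> nth_elem a i < nth_elem b (i + 1)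
              \<and> nth_elem b (i + 1) < nth_elem a (i + 1))"
        using nested [OF ab(2,1), of i] i le by auto
    next
      assume "card b < card a"
      then show "\<not> (nth_elem a (card b) < nth_elem b (card b) \<and> nth_elem b (card b) < nth_elem a (card b + 1))"
        using nested [OF ab, of "card b"] pos by auto
    qed
  qed
qed

section \<open>Uniqueness and existence of non-crossing matchings\<close>

text \<open>Induction from left to right. If \<open>g x < h x\<close>, then \<open>h x\<close> lies
  under the arc of \<open>g\<close> at \<open>x\<close>, so \<open>h x = g z\<close> for some
  \<open>z < x\<close>; by induction \<open>h z = h x\<close>, against the injectivity of
  \<open>h\<close>.\<close>

lemma nc_matching_unique:
  fixes A :: "nat set"
  assumes g: "nc_matching A lev g" and h: "nc_matching A lev h" and "x \<in> A" "0 < lev x"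
  shows "g x = h x"
  using assms(3,4)
proof (induction x rule: less_induct)
  case (less x)
  have no: "\<not> g' x < h' x"
    if g': "nc_matching A lev g'" and h': "nc_matching A lev h'"
      and IH: "\<And>z. z < x \<Longrightarrow> z \<in> A \<Longrightarrow> 0 < lev z \<Longrightarrow> g' z = h' z" for g' h'
  proof
    assume "g' x < h' x"
    moreover have "h' x \<in> A" "Suc (lev (h' x)) = lev x" "h' x < x"
      using h' less.prems by (auto simp: nc_matching_def)
    ultimately obtain z where z: "z \<in> A" "0 < lev z" "g' z = h' x" "z < x"
      using nc_matchingD [OF g' less.prems(1)] by blast
    then have "h' z = h' x" using IH by simp
    then have "z = x"
      using h' z less.prems unfolding nc_matching_def inj_on_def by simp
    then show False using z by simp
  qed
  show ?case using no [OF g h] no [OF h g] less.IH by (metis linorder_neqE)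
qed

text \<open>Parenthesis matching with opening brackets at \<open>A\<close> and closing ones at
  \<open>B\<close>: the least element of \<open>B\<close> takes the nearest element of
  \<open>A\<close> on its left, and the others are matched by induction. The injection
  \<open>f\<close> certifies that enough elements of \<open>A\<close> are available.\<close>

lemma ex_nc_injection:
  fixes B :: "nat set"
  assumes "finite B" "inj_on f B" "\<And>b. b \<in> B \<Longrightarrow> f b \<in> A \<and> f b < b"
  shows "\<exists>g. inj_on g B \<and> (\<forall>b\<in>B. g b \<in> A \<and> g b < b) \<and>
           (\<forall>b\<in>B. \<forall>a\<in>A. g b < a \<and> a < b \<longrightarrow> (\<exists>b'\<in>B. g b' = a \<and> b' < b))"
  using assms
proof (induction B arbitrary: A f rule: finite_linorder_min_induct)
  case empty
  then show ?case by simp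
next
  case (insert b B)
  define a where "a = Max {a \<in> A. a < b}"
  have fin: "finite {a \<in> A. a < b}" by simp
  have fb: "f b \<in> A" "f b < b" using insert.prems by auto
  then have "a \<in> {a \<in> A. a < b}" unfolding a_def by (intro Max_in [OF fin]) auto
  then have a: "a \<in> A" "a < b" by auto
  have amax: "a' \<le> a" if "a' \<in> A" "a' < b" for a'
    using Max_ge [OF fin, of a'] that by (simp add: a_def)
  \<comment> \<open>The element that \<open>f\<close> sends to \<open>a\<close>, if any, is
    redirected to \<open>f b\<close>. This value is free once \<open>b\<close> is removed, and it
    lies left of \<open>b\<close>, hence left of all of \<open>B\<close>.\<close>
  define f' where "f' x = (if f x = a then f b else f x)" for x
  have bB: "b \<notin> B" using insert.hyps by auto
  have "inj_on f' B"
    using insert.prems(1) bB unfolding f'_def inj_on_def by (metis insert_iff)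
  moreover have "f' x \<in> A - {a} \<and> f' x < x" if "x \<in> B" for x
  proof -
    have "f x \<in> A" "f x < x" "b < x" "f x \<noteq> f b" using insert that bB by (auto simp: inj_on_def)
    then show ?thesis using fb by (auto simp: f'_def)
  qed
  ultimately obtain g where g: "inj_on g B" "\<forall>x\<in>B. g x \<in> A - {a} \<and> g x < x"
      "\<forall>x\<in>B. \<forall>y\<in>A - {a}. g x < y \<and> y < x \<longrightarrow> (\<exists>z\<in>B. g z = y \<and> z < x)"
    using insert.IH [of f' "A - {a}"] by blast
  have "inj_on (g(b := a)) (insert b B)"
    using g bB by (auto simp: inj_on_def)
  moreover have "\<forall>x\<in>insert b B. (g(b := a)) x \<in> A \<and> (g(b := a)) x < x"
    using g a by auto
  moreover have "\<exists>z\<in>insert b B. (g(b := a)) z = y \<and> z < x"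
    if "x \<in> insert b B" "y \<in> A" "(g(b := a)) x < y" "y < x" for x y
  proof -
    have "x \<noteq> b" using amax that by fastforce
    then have x: "x \<in> B" "b < x" and gx: "g x < y" using that insert.hyps by auto
    show ?thesis
    proof (cases "y = a")
      case True then show ?thesis using x by auto
    next
      case False
      then obtain z where "z \<in> B" "g z = y" "z < x" using g(3) x gx \<open>y \<in> A\<close> \<open>y < x\<close> by blast
      then show ?thesis using bB by (intro bexI [of _ z]) auto
    qed
  qed
  ultimately show ?case by (intro exI [of _ "g(b := a)"]) blast
qed

text \<open>The levels decouple: each arc involves only two adjacent levels, so one matching is
  chosen for every \<open>r\<close> between the levels \<open>Suc r\<close> and \<open>r\<close>,
  and these are glued.\<close>

lemma ex_nc_matching:
  fixes A :: "nat set"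
  assumes "finite A" "inj_on f {x \<in> A. 0 < lev x}"
    and f: "\<And>x. x \<in> A \<Longrightarrow> 0 < lev x \<Longrightarrow> f x \<in> A \<and> Suc (lev (f x)) = lev x \<and> f x < x"
  obtains g where "nc_matching A lev g"
proof -
  let ?L = "\<lambda>r. {x \<in> A. lev x = r}"
  have "\<exists>g. inj_on g (?L (Suc r)) \<and> (\<forall>x\<in>?L (Suc r). g x \<in> ?L r \<and> g x < x) \<and>
      (\<forall>x\<in>?L (Suc r). \<forall>y\<in>?L r. g x < y \<and> y < x \<longrightarrow> (\<exists>z\<in>?L (Suc r). g z = y \<and> z < x))" for r
  proof (rule ex_nc_injection [of _ f])
    show "finite (?L (Suc r))" using assms(1) by simp
    show "inj_on f (?L (Suc r))" using assms(2) by (rule inj_on_subset) auto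
    show "f b \<in> ?L r \<and> f b < b" if "b \<in> ?L (Suc r)" for b using f [of b] that by simp
  qed
  then obtain G where G': "\<And>r. inj_on (G r) (?L (Suc r)) \<and>
      (\<forall>x\<in>?L (Suc r). G r x \<in> ?L r \<and> G r x < x) \<and>
      (\<forall>x\<in>?L (Suc r). \<forall>y\<in>?L r. G r x < y \<and> y < x \<longrightarrow> (\<exists>z\<in>?L (Suc r). G r z = y \<and> z < x))"
    using choice [of "\<lambda>r g. inj_on g (?L (Suc r)) \<and> (\<forall>x\<in>?L (Suc r). g x \<in> ?L r \<and> g x < x) \<and>
      (\<forall>x\<in>?L (Suc r). \<forall>y\<in>?L r. g x < y \<and> y < x \<longrightarrow> (\<exists>z\<in>?L (Suc r). g z = y \<and> z < x))"] by blast
  have G: "inj_on (G r) (?L (Suc r))"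
      "x \<in> A \<Longrightarrow> lev x = Suc r \<Longrightarrow> G r x \<in> A \<and> lev (G r x) = r \<and> G r x < x" for r x
    using G' [of r] by blast+
  have nested: "\<exists>z\<in>A. lev z = Suc r \<and> G r z = y \<and> z < x"
    if "x \<in> A" "lev x = Suc r" "y \<in> A" "lev y = r" "G r x < y" "y < x" for r x y
  proof -
    have "x \<in> ?L (Suc r)" "y \<in> ?L r" using that by simp_all
    then have "\<exists>z\<in>?L (Suc r). G r z = y \<and> z < x" using G' [of r] that(5,6) by blast
    then show ?thesis by auto
  qed
  \<comment> \<open>The matching with index \<open>lev x - 1\<close> starts on the level of
    \<open>x\<close>; at level 0 the value is junk.\<close>
  define g where "g x = G (lev x - 1) x" for x
  have g: "g x \<in> A \<and> Suc (lev (g x)) = lev x \<and> g x < x" if "x \<in> A" "0 < lev x" for x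
    using G(2) [of x "lev x - 1"] that by (simp add: g_def)
  have "inj_on g {x \<in> A. 0 < lev x}"
  proof (rule inj_onI)
    fix x y assume xy: "x \<in> {x \<in> A. 0 < lev x}" "y \<in> {x \<in> A. 0 < lev x}" "g x = g y"
    then have "lev x = lev y" using g by (metis mem_Collect_eq)
    then show "x = y"
      using xy G(1) [of "lev x - 1"] by (auto simp: g_def inj_on_def)
  qed
  moreover have "\<exists>z\<in>A. 0 < lev z \<and> g z = y \<and> z < x"
    if "x \<in> A" "y \<in> A" "Suc (lev y) = lev x" "g x < y" "y < x" for x y
  proof -
    have "G (lev y) x < y" using that(3,4) unfolding g_def by (metis diff_Suc_1)
    from nested [OF that(1) that(3) [symmetric] that(2) refl this that(5)]
    obtain z where "z \<in> A" "lev z = Suc (lev y)" "G (lev y) z = y" "z < x" by blast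
    then show ?thesis by (intro bexI [of _ z]) (simp_all add: g_def)
  qed
  ultimately have "nc_matching A lev g" unfolding nc_matching_def using g by blast
  then show ?thesis by (rule that)
qed

text \<open>The blocks are the chains of arcs, that is, the fibres of the map sending an element to
  the end of its chain at level 0. A chain passes through all lower levels and has only one element
  on each, so the ranks in the blocks are the given levels.\<close>

lemma partition_of_matching:
  fixes A :: "nat set"
  assumes fin: "finite A" and nc: "nc_matching A lev g"
  obtains P where "partition_on A P" "\<And>x. x \<in> A \<Longrightarrow> level P x = lev x"
    "\<And>x. x \<in> A \<Longrightarrow> 0 < lev x \<Longrightarrow> prev P x = g x"
proof -
  have g: "g x \<in> A" "Suc (lev (g x)) = lev x" "g x < x" if "x \<in> A" "0 < lev x" for x
    using nc that by (auto simp: nc_matching_def)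
  have inj: "inj_on g {x \<in> A. 0 < lev x}" using nc by (simp add: nc_matching_def)
  define root where "root x = (g ^^ lev x) x" for x
  have root_g: "root (g x) = root x" if "x \<in> A" "0 < lev x" for x
    using g(2) [OF that] unfolding root_def by (metis comp_apply funpow_Suc_right)
  have iter: "(g ^^ d) x \<in> A \<and> lev ((g ^^ d) x) + d = lev x \<and> (g ^^ d) x \<le> x \<and>
      (0 < d \<longrightarrow> (g ^^ d) x < x) \<and> root ((g ^^ d) x) = root x" if "d \<le> lev x" "x \<in> A" for d x
    using that
  proof (induction d)
    case (Suc d)
    let ?w = "(g ^^ d) x"
    have w: "?w \<in> A" "0 < lev ?w" "lev ?w + d = lev x" "?w \<le> x" "root ?w = root x" using Suc by auto
    show ?case using g [OF w(1,2)] root_g [OF w(1,2)] w by auto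
  qed simp
  have root_inj: "x = y" if "x \<in> A" "y \<in> A" "lev x = lev y" "root x = root y" for x y
    using that
  proof (induction "lev x" arbitrary: x y)
    case 0 then show ?case by (simp add: root_def)
  next
    case (Suc l)
    then have pos: "0 < lev x" "0 < lev y" by simp_all
    have "g x = g y"
      using Suc.hyps(2) Suc.prems g(1,2) [OF Suc.prems(1) pos(1)] g(1,2) [OF Suc.prems(2) pos(2)]
        root_g [OF Suc.prems(1) pos(1)] root_g [OF Suc.prems(2) pos(2)]
      by - (rule Suc.hyps(1), simp_all, linarith?)
    then show ?case using inj pos Suc.prems by (auto simp: inj_on_def)
  qed
  \<comment> \<open>Otherwise descending from \<open>y\<close> to the level of \<open>x\<close>
    would lead to \<open>x\<close>, by \<open>root_inj\<close>; but arcs descend to the left, and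
    \<open>y < x\<close>.\<close>
  have root_mono: "lev y < lev x" if "x \<in> A" "y \<in> A" "root x = root y" "y < x" for x y
  proof (rule ccontr)
    assume "\<not> lev y < lev x"
    then have "(g ^^ (lev y - lev x)) y = x"
      using iter [of "lev y - lev x" y] that by - (rule root_inj, auto)
    then show False using iter [of "lev y - lev x" y] that by auto
  qed
  define P where "P = (\<lambda>z. {y \<in> A. root y = z}) ` root ` A"
  have part: "partition_on A P"
    unfolding P_def by (rule partition_onI) (auto simp: disjnt_def)
  interpret finite_partition A P using part fin by unfold_locales
  have block: "block P x = {y \<in> A. root y = root x}" if "x \<in> A" for x
    using that by (intro block_eq) (auto simp: P_def)
  have level: "level P x = lev x" if x: "x \<in> A" for x
  proof -
    let ?S = "{y \<in> A. root y = root x \<and> y < x}"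
    have "inj_on lev ?S" by (rule inj_onI) (auto intro: root_inj)
    \<comment> \<open>Each level \<open>i\<close> below \<open>lev x\<close> is attained by going
      down \<open>lev x - i\<close> steps from \<open>x\<close>.\<close>
    moreover have "lev ` ?S = {..<lev x}"
    proof (intro equalityI subsetI)
      fix i assume "i \<in> lev ` ?S" then show "i \<in> {..<lev x}" using root_mono x by auto
    next
      fix i assume i: "i \<in> {..<lev x}"
      then show "i \<in> lev ` ?S"
        using iter [of "lev x - i" x] x by (intro image_eqI [of _ _ "(g ^^ (lev x - i)) x"]) auto
    qed
    ultimately have "card ?S = lev x" by (metis card_image card_lessThan)
    moreover have "{y \<in> block P x. y < x} = ?S" using block [OF x] by auto
    ultimately show ?thesis by (simp add: level_def rank_def)
  qed
  have "prev P x = g x" if "x \<in> A" "0 < lev x" for x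
    using that g [of x] root_g [of x] level block by (intro prev_eqI) auto
  then show ?thesis using that part level by blast
qed

subsection \<open>Segments and row lengths\<close>

text \<open>For \<open>x\<close> in \<open>{1..sum_list mu}\<close> this is the index of the segment
  containing \<open>x\<close>, counted from 1. The least choice skips the empty segments that come
  from zeros in \<open>mu\<close>.\<close>

definition seg :: "nat list \<Rightarrow> nat \<Rightarrow> nat" where
  "seg mu x = (LEAST j. x \<le> sum_list (take j mu))"

lemma sum_list_take_mono: "i \<le> j \<Longrightarrow> sum_list (take i mu) \<le> sum_list (take j (mu :: nat list))"
  using take_add [of i "j - i" mu] by simp

text \<open>A Galois connection between \<open>seg\<close> and the prefix sums of \<open>mu\<close>,
  from which monotonicity and the link with \<open>segment\<close> follow.\<close>

lemma seg_le_iff: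
  assumes "x \<le> sum_list mu"
  shows "seg mu x \<le> j \<longleftrightarrow> x \<le> sum_list (take j mu)"
proof
  assume "seg mu x \<le> j"
  then have "sum_list (take (seg mu x) mu) \<le> sum_list (take j mu)" by (rule sum_list_take_mono)
  moreover have "x \<le> sum_list (take (seg mu x) mu)"
    unfolding seg_def using LeastI [of "\<lambda>j. x \<le> sum_list (take j mu)" "length mu"] assms by simp
  ultimately show "x \<le> sum_list (take j mu)" by simp
qed (simp add: seg_def Least_le)

lemma seg_mono: "x \<le> y \<Longrightarrow> y \<le> sum_list mu \<Longrightarrow> seg mu x \<le> seg mu y"
  using seg_le_iff [of y mu "seg mu y"] seg_le_iff [of x mu "seg mu y"] by simp

lemma mem_segment_iff:
  assumes "x \<le> sum_list mu" "1 \<le> i"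
  shows "x \<in> segment mu i \<longleftrightarrow> seg mu x = i"
  using seg_le_iff [OF assms(1), of i] seg_le_iff [OF assms(1), of "i - 1"] assms(2)
  by (auto simp: segment_def)

lemma seg_range:
  assumes "x \<in> {1..sum_list mu}"
  shows "seg mu x \<in> {1..length mu}"
  using seg_le_iff [of x mu 0] seg_le_iff [of x mu "length mu"] assms by auto

lemma segment_subset: "segment mu i \<subseteq> {1..sum_list mu}"
  \<comment> \<open>The index \<open>i\<close> may exceed \<open>length mu\<close>, where
    \<open>take\<close> returns all of \<open>mu\<close>.\<close>
  using sum_list_take_mono [of i "max i (length mu)" mu] by (auto simp: segment_def)

lemma card_segment:
  assumes "i \<in> {1..length mu}"
  shows "card (segment mu i) = mu ! (i - 1)"
  using take_Suc_conv_app_nth [of "i - 1" mu] assms by (auto simp: segment_def)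

text \<open>The shape is continued by empty rows, so that every natural number is a row
  index.\<close>

definition row_length :: "nat list \<Rightarrow> nat \<Rightarrow> nat" where
  "row_length lam r = (if r < length lam then lam ! r else 0)"

lemma mem_young_diagram_iff: "(r, c) \<in> young_diagram lam \<longleftrightarrow> c < row_length lam r"
  by (simp add: young_diagram_def row_length_def)

text \<open>The multiplicity of \<open>Suc i\<close> is the difference of the tail sizes at
  \<open>i\<close> and \<open>Suc i\<close>. Tails do not see the element 0, which the hypotheses
  exclude.\<close>

lemma mset_eq_iff_tail_sizes:
  assumes "0 \<notin># M" "0 \<notin># N"
  shows "M = N \<longleftrightarrow> (\<forall>i::nat. size (filter_mset ((<) i) M) = size (filter_mset ((<) i) N))"
proof
  assume eq: "\<forall>i. size (filter_mset ((<) i) M) = size (filter_mset ((<) i) N)"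
  have split: "size (filter_mset ((<) i) K) = count K (Suc i) + size (filter_mset ((<) (Suc i)) K)" for i K
  proof -
    have "filter_mset ((<) i) K = {#x \<in># K. x = Suc i#} + filter_mset ((<) (Suc i)) K"
      by (rule multiset_eqI) (auto simp: Suc_lessI)
    then show ?thesis by (simp add: filter_eq_replicate_mset)
  qed
  show "M = N"
  proof (rule multiset_eqI)
    fix x show "count M x = count N x"
    proof (cases x)
      case 0 then show ?thesis using assms by (simp add: not_in_iff)
    next
      case (Suc i)
      then show ?thesis using split [of i M] split [of i N] eq by simp
    qed
  qed
qed simp

text \<open>The classes are the nonempty fibres of \<open>f\<close>, one for each value.\<close>

lemma card_quotient_kernel:
  assumes "\<And>x y. (x, y) \<in> r \<longleftrightarrow> x \<in> X \<and> y \<in> X \<and> f x = f y"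
  shows "card (X // r) = card (f ` X)"
proof -
  let ?h = "\<lambda>t. {y \<in> X. f y = t}"
  have "r `` {x} = ?h (f x)" if "x \<in> X" for x
    using assms that by auto
  then have "X // r = ?h ` f ` X"
    by (auto simp: quotient_def)
  moreover have "inj_on ?h (f ` X)"
    by (rule inj_onI) blast
  ultimately show ?thesis by (simp add: card_image)
qed

subsection \<open>Tableaux of fixed shape and weight\<close>

locale shape_weight =
  fixes n :: nat and lam mu :: "nat list"
  assumes shape: "is_partition_of lam n" and weight: "sum_list mu = n"
begin

abbreviation "A \<equiv> {1..n}"

section \<open>Rows and columns of the shape, and block sizes\<close>

lemma row_length_antimono: "r \<le> s \<Longrightarrow> row_length lam s \<le> row_length lam r"
  using shape sorted_wrt_nth_less [of "\<lambda>x y. y \<le> x" lam r s]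
  by (cases "r = s") (auto simp: row_length_def is_partition_of_def)

lemma finite_young_diagram: "finite (young_diagram lam)"
  and card_young_diagram: "card (young_diagram lam) = n"
proof -
  have eq: "young_diagram lam = (SIGMA r:{..<length lam}. {..<lam ! r})"
    by (auto simp: young_diagram_def)
  show "finite (young_diagram lam)" by (simp add: eq)
  show "card (young_diagram lam) = n"
    using shape by (simp add: eq is_partition_of_def sum_list_sum_nth atLeast0LessThan)
qed

text \<open>Row lengths weakly decrease, so each column occupies an initial interval of
  rows.\<close>

lemma column_height: "i < card {r. (r, c) \<in> young_diagram lam} \<longleftrightarrow> c < row_length lam i"
proof
  have fin: "finite {r. (r, c) \<in> young_diagram lam}"
    by (rule finite_subset [of _ "{..<length lam}"]) (auto simp: young_diagram_def)
  assume "c < row_length lam i"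
  then have "{..i} \<subseteq> {r. (r, c) \<in> young_diagram lam}"
    using row_length_antimono by (fastforce simp: mem_young_diagram_iff)
  then show "i < card {r. (r, c) \<in> young_diagram lam}"
    using card_mono [OF fin, of "{..i}"] by simp
next
  assume i: "i < card {r. (r, c) \<in> young_diagram lam}"
  show "c < row_length lam i"
  proof (rule ccontr)
    assume "\<not> c < row_length lam i"
    then have "r < i" if "c < row_length lam r" for r
      using row_length_antimono [of i r] that by (meson le_less_trans not_less less_le_trans)
    then have "{r. (r, c) \<in> young_diagram lam} \<subseteq> {..<i}" by (auto simp: mem_young_diagram_iff)
    then have "card {r. (r, c) \<in> young_diagram lam} \<le> card {..<i}" by (intro card_mono) simp_all
    then show False using i by simp
  qed
qed

text \<open>The columns of height greater than \<open>i\<close> are those that meet row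
  \<open>i\<close>: conjugating twice gives back the shape.\<close>

lemma tail_size_conjugate:
  "size (filter_mset ((<) i) (mset (conjugate_partition lam))) = row_length lam i"
proof -
  define m where "m = (if lam = [] then 0 else hd lam)"
  have m: "m = row_length lam 0" by (simp add: m_def row_length_def hd_conv_nth)
  have "size (filter_mset ((<) i) (mset (conjugate_partition lam)))
      = length (filter (\<lambda>c. i < card {r. (r, c) \<in> young_diagram lam}) [0..<m])"
    unfolding conjugate_partition_def m_def [symmetric] mset_filter [symmetric] size_mset
    by (simp add: filter_map comp_def)
  also have "\<dots> = card (set (filter (\<lambda>c. c < row_length lam i) [0..<m]))"
    by (subst distinct_card) (simp_all add: column_height)
  also have "set (filter (\<lambda>c. c < row_length lam i) [0..<m]) = {..<row_length lam i}"
    using row_length_antimono [of 0 i] m by auto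
  finally show ?thesis by simp
qed

lemma zero_notin_conjugate: "0 \<notin># mset (conjugate_partition lam)"
proof
  assume "0 \<in># mset (conjugate_partition lam)"
  then obtain c where "lam \<noteq> []" "c < hd lam" "card {r. (r, c) \<in> young_diagram lam} = 0"
    by (auto simp: conjugate_partition_def split: if_splits)
  then show False using column_height [of 0 c] by (simp add: row_length_def hd_conv_nth)
qed

text \<open>A block has an element of level \<open>i\<close> exactly if it has more than
  \<open>i\<close> elements, and then only one. So the size of level \<open>i\<close> counts the
  blocks larger than \<open>i\<close>, and these counts determine the multiset of block
  sizes.\<close>

lemma block_sizes_iff:
  assumes "partition_on A P"
  shows "image_mset card (mset_set P) = mset (conjugate_partition lam) \<longleftrightarrow>
    (\<forall>i. card {x \<in> A. level P x = i} = row_length lam i)"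
proof -
  interpret finite_partition A P using assms by unfold_locales simp_all
  have fin: "finite P" by (subst partition_eq_blocks) simp
  have sizes: "size (filter_mset ((<) i) (image_mset card (mset_set P))) = card {x \<in> A. level P x = i}" for i
  proof -
    have "inj_on (block P) {x \<in> A. level P x = i}"
      by (rule inj_onI) (use level_eq_iff in auto)
    moreover have "block P ` {x \<in> A. level P x = i} = {a \<in> P. i < card a}"
    proof (intro equalityI subsetI)
      fix a assume "a \<in> block P ` {x \<in> A. level P x = i}"
      then show "a \<in> {a \<in> P. i < card a}" using block_in level_less_card by auto
    next
      fix a assume "a \<in> {a \<in> P. i < card a}"
      then obtain x where "x \<in> a" "level P x = i" "a \<in> P" using ex_level by auto
      then show "a \<in> block P ` {x \<in> A. level P x = i}"
        using block_eq [of a x] part_subset [of a] by auto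
    qed
    ultimately have "card {x \<in> A. level P x = i} = card {a \<in> P. i < card a}"
      using card_image [of "block P" "{x \<in> A. level P x = i}"] by simp
    then show ?thesis using fin by (simp add: filter_mset_image_mset)
  qed
  have pos: "0 \<notin># image_mset card (mset_set P)"
    using fin finite_part partition by (auto simp: partition_on_def)
  show ?thesis
    unfolding mset_eq_iff_tail_sizes [OF pos zero_notin_conjugate] tail_size_conjugate sizes ..
qed

section \<open>Transversal tableaux in terms of levels\<close>

definition levelled :: "(nat \<Rightarrow> nat) \<Rightarrow> bool" where
  "levelled lev \<longleftrightarrow> (\<forall>i. card {x \<in> A. lev x = i} = row_length lam i)"

text \<open>Segments are intervals, so a block with two elements in one segment has two neighbouring
  elements there. Transversality thus becomes a condition on \<open>prev\<close>.\<close>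

lemma transversal_iff:
  "P \<in> transversal_nct n lam mu \<longleftrightarrow> partition_on A P \<and> levelled (level P) \<and>
     nc_matching A (level P) (prev P) \<and>
     (\<forall>x\<in>A. 0 < level P x \<longrightarrow> seg mu (prev P x) < seg mu x)"
proof (cases "partition_on A P")
  case False
  then show ?thesis by (simp add: transversal_nct_def noncrossing_tableaux_def)
next
  case True
  interpret finite_partition A P using True by unfold_locales simp_all
  have transversal: "(\<forall>a\<in>P. \<forall>i\<in>{1..length mu}. card (a \<inter> segment mu i) \<le> 1) \<longleftrightarrow>
    (\<forall>x\<in>A. 0 < level P x \<longrightarrow> seg mu (prev P x) < seg mu x)"
  proof (intro iffI ballI impI)
    fix x assume *: "\<forall>a\<in>P. \<forall>i\<in>{1..length mu}. card (a \<inter> segment mu i) \<le> 1"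
      and x: "x \<in> A" "0 < level P x"
    have p: "prev P x \<in> A" "prev P x < x" using prev_in [OF x] prev_less [OF x] by auto
    have "seg mu (prev P x) \<noteq> seg mu x"
    proof
      assume eq: "seg mu (prev P x) = seg mu x"
      have i: "seg mu x \<in> {1..length mu}" using seg_range x weight by simp
      have "{prev P x, x} \<subseteq> block P x \<inter> segment mu (seg mu x)"
        using x p i eq weight mem_segment_iff [of x mu "seg mu x"] mem_segment_iff [of "prev P x" mu "seg mu x"]
          mem_block_iff [OF x(1)] block_prev [OF x] by auto
      then have "card {prev P x, x} \<le> card (block P x \<inter> segment mu (seg mu x))"
        using finite_part [OF block_in [OF x(1)]] by (intro card_mono) simp_all
      moreover have "card (block P x \<inter> segment mu (seg mu x)) \<le> 1"
        using * i block_in [OF x(1)] by blast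
      ultimately show False using p(2) by simp
    qed
    moreover have "seg mu (prev P x) \<le> seg mu x" using seg_mono p x weight by simp
    ultimately show "seg mu (prev P x) < seg mu x" by simp
  next
    fix a i assume *: "\<forall>x\<in>A. 0 < level P x \<longrightarrow> seg mu (prev P x) < seg mu x"
      and a: "a \<in> P" and i: "i \<in> {1..length mu}"
    have no: "\<not> x < y" if "x \<in> a" "y \<in> a" "seg mu x = seg mu y" for x y
    proof
      assume less: "x < y"
      have "x \<in> A" "y \<in> A" "block P x = block P y"
        using that a part_subset [OF a] block_eq [OF a] by auto
      then have "0 < level P y" "x \<le> prev P y" using le_prev less by auto
      moreover from this have "seg mu (prev P y) < seg mu y" using * \<open>y \<in> A\<close> by blast
      ultimately show False
        using \<open>y \<in> A\<close> prev_in [of y] seg_mono [of x "prev P y" mu] that(3) weight by simp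
    qed
    have "\<forall>x\<in>a \<inter> segment mu i. \<forall>y\<in>a \<inter> segment mu i. x = y"
      using no part_subset [OF a] mem_segment_iff weight i
      by (metis IntE atLeastAtMost_iff linorder_neqE_nat subsetD)
    then show "card (a \<inter> segment mu i) \<le> 1"
      using finite_part [OF a] by (simp add: card_le_Suc0_iff_eq)
  qed
  show ?thesis
    unfolding transversal_nct_def noncrossing_tableaux_def levelled_def mem_Collect_eq
      transversal block_sizes_iff [OF True] noncrossing_iff_nc_matching
    by (simp only: True simp_thms conj_assoc)
qed

section \<open>The tableau of a level function\<close>

definition cell :: "(nat \<Rightarrow> nat) \<Rightarrow> nat \<Rightarrow> nat \<times> nat" where
  "cell lev x = (lev x, rank {y \<in> A. lev y = lev x} x)"

text \<open>Only the levels enter, not the blocks. Outside the diagram \<open>restrict\<close>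
  supplies the default value of extensional functions.\<close>

definition tableau :: "(nat \<Rightarrow> nat) \<Rightarrow> nat \<times> nat \<Rightarrow> nat" where
  "tableau lev = restrict (\<lambda>p. seg mu (inv_into A (cell lev) p)) (young_diagram lam)"

lemma bij_betw_cell:
  assumes "levelled lev"
  shows "bij_betw (cell lev) A (young_diagram lam)"
proof -
  have rank: "bij_betw (rank {y \<in> A. lev y = r}) {y \<in> A. lev y = r} {..<row_length lam r}" for r
    using bij_betw_rank [of "{y \<in> A. lev y = r}"] assms by (simp add: levelled_def)
  have "inj_on (cell lev) A"
    by (rule inj_onI) (auto simp: cell_def rank_eq_iff)
  moreover have "cell lev ` A = young_diagram lam"
  proof (intro equalityI subsetI)
    fix p assume "p \<in> cell lev ` A"
    then show "p \<in> young_diagram lam"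
      using rank unfolding bij_betw_def by (fastforce simp: cell_def mem_young_diagram_iff)
  next
    fix p assume "p \<in> young_diagram lam"
    then have "snd p \<in> {..<row_length lam (fst p)}" by (cases p) (simp add: mem_young_diagram_iff)
    then obtain x where "x \<in> A" "lev x = fst p" "snd p = rank {y \<in> A. lev y = fst p} x"
      using rank [of "fst p"] unfolding bij_betw_def by auto
    then show "p \<in> cell lev ` A" by (intro image_eqI [of _ _ x]) (auto simp: cell_def prod_eq_iff)
  qed
  ultimately show ?thesis by (simp add: bij_betw_def)
qed

lemma tableau_cell:
  assumes "levelled lev" "x \<in> A"
  shows "tableau lev (cell lev x) = seg mu x"
proof -
  have b: "bij_betw (cell lev) A (young_diagram lam)" using bij_betw_cell assms by simp
  then have "cell lev x \<in> young_diagram lam" using assms(2) by (auto simp: bij_betw_def)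
  moreover have "inv_into A (cell lev) (cell lev x) = x"
    using b assms(2) by (simp add: bij_betw_def inv_into_f_f)
  ultimately show ?thesis by (simp add: tableau_def)
qed

lemma ex_cell:
  assumes "levelled lev" "p \<in> young_diagram lam"
  obtains x where "x \<in> A" "p = cell lev x"
  using bij_betw_cell [OF assms(1)] assms(2) unfolding bij_betw_def by blast

text \<open>Segments weakly increase along a level, so the cells with entry at most \<open>j\<close>
  form an initial part of row \<open>r\<close>, whose length is the cardinality on the right. Hence
  these cardinalities determine the tableau.\<close>

lemma tableau_le_iff:
  assumes "levelled lev" "(r, c) \<in> young_diagram lam"
  shows "tableau lev (r, c) \<le> j \<longleftrightarrow> c < card {x \<in> A. lev x = r \<and> seg mu x \<le> j}"
proof -
  obtain x where x: "x \<in> A" "(r, c) = cell lev x" using ex_cell assms by metis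
  then have r: "lev x = r" and c: "rank {y \<in> A. lev y = r} x = c" by (auto simp: cell_def)
  have "rank {y \<in> A. lev y = r} x < card {x \<in> A. lev x = r \<and> seg mu x \<le> j} \<longleftrightarrow>
      x \<in> {x \<in> A. lev x = r \<and> seg mu x \<le> j}"
  proof (rule rank_less_card_downset)
    fix y z assume "z \<in> {x \<in> A. lev x = r \<and> seg mu x \<le> j}" "y \<in> {y \<in> A. lev y = r}" "y < z"
    then show "y \<in> {x \<in> A. lev x = r \<and> seg mu x \<le> j}"
      using seg_mono [of y z mu] weight by auto
  qed (use x r in auto)
  then show ?thesis using tableau_cell [OF assms(1) x(1)] x r c by simp
qed

text \<open>Columns are strict by counting: if \<open>j\<close> is the entry at
  \<open>(Suc r, c)\<close>, then more than \<open>c\<close> elements of level \<open>Suc r\<close>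
  have segment at most \<open>j\<close>. The map \<open>f\<close> injects them into the elements of
  level \<open>r\<close> with segment at most \<open>j - 1\<close>, so the entry above is at most
  \<open>j - 1\<close>.\<close>

lemma tableau_semistandard:
  assumes lev: "levelled lev" and inj: "inj_on f {x \<in> A. 0 < lev x}"
    and f: "\<And>x. x \<in> A \<Longrightarrow> 0 < lev x \<Longrightarrow> f x \<in> A \<and> Suc (lev (f x)) = lev x \<and> seg mu (f x) < seg mu x"
  shows "tableau lev \<in> semistandard_tableaux lam mu"
proof -
  let ?T = "tableau lev"
  have range: "?T p \<in> {1..length mu}" if "p \<in> young_diagram lam" for p
    using ex_cell [OF lev that] tableau_cell [OF lev] seg_range weight by metis
  moreover have "?T (r, c) \<le> ?T (r, Suc c)"
    if "(r, c) \<in> young_diagram lam" "(r, Suc c) \<in> young_diagram lam" for r c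
    using tableau_le_iff [OF lev that(1), of "?T (r, Suc c)"] tableau_le_iff [OF lev that(2), of "?T (r, Suc c)"]
    by simp
  moreover have "?T (r, c) < ?T (Suc r, c)"
    if "(r, c) \<in> young_diagram lam" "(Suc r, c) \<in> young_diagram lam" for r c
  proof -
    let ?j = "?T (Suc r, c)"
    have "c < card {x \<in> A. lev x = Suc r \<and> seg mu x \<le> ?j}"
      using tableau_le_iff [OF lev that(2), of ?j] by simp
    also have "\<dots> \<le> card {x \<in> A. lev x = r \<and> seg mu x \<le> ?j - 1}"
    proof (rule card_inj_on_le [of f])
      show "inj_on f {x \<in> A. lev x = Suc r \<and> seg mu x \<le> ?j}"
        using inj by (rule inj_on_subset) auto
      show "f ` {x \<in> A. lev x = Suc r \<and> seg mu x \<le> ?j} \<subseteq> {x \<in> A. lev x = r \<and> seg mu x \<le> ?j - 1}"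
      proof (rule image_subsetI)
        fix x assume "x \<in> {x \<in> A. lev x = Suc r \<and> seg mu x \<le> ?j}"
        then show "f x \<in> {x \<in> A. lev x = r \<and> seg mu x \<le> ?j - 1}" using f [of x] by auto
      qed
    qed simp
    finally have "?T (r, c) \<le> ?j - 1" using tableau_le_iff [OF lev that(1)] by simp
    \<comment> \<open>This ensures that the subtraction in \<open>?j - 1\<close> is not
      truncated.\<close>
    moreover have "1 \<le> ?j" using range [OF that(2)] by simp
    ultimately show ?thesis by linarith
  qed
  moreover have "card {p \<in> young_diagram lam. ?T p = i} = mu ! (i - 1)" if i: "i \<in> {1..length mu}" for i
  proof -
    have b: "inj_on (cell lev) A" "cell lev ` A = young_diagram lam"
      using bij_betw_cell [OF lev] by (simp_all add: bij_betw_def)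
    have "segment mu i = {x \<in> A. seg mu x = i}"
      using segment_subset [of mu i] mem_segment_iff [of _ mu i] i weight by auto
    then have "{p \<in> young_diagram lam. ?T p = i} = cell lev ` segment mu i"
      unfolding b(2) [symmetric] Compr_image_eq by (simp add: tableau_cell [OF lev] cong: conj_cong)
    moreover have "inj_on (cell lev) (segment mu i)"
      using inj_on_subset [OF b(1)] segment_subset [of mu i] weight by simp
    ultimately show ?thesis using card_segment [OF i] by (simp add: card_image)
  qed
  moreover have "?T \<in> young_diagram lam \<rightarrow>\<^sub>E {1..length mu}"
    using range by (simp add: PiE_iff tableau_def)
  ultimately show ?thesis by (simp add: semistandard_tableaux_def)
qed

section \<open>Equivalent partitions and equal tableaux\<close>

lemma transversal_partition:
  assumes "P \<in> transversal_nct n lam mu"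
  shows "finite_partition A P"
  using assms by unfold_locales (simp_all add: transversal_iff)

text \<open>If \<open>x < y\<close> were in one segment, then \<open>x\<close> would lie under the
  arc ending at \<open>y\<close>, since that arc starts in an earlier segment. So \<open>x\<close>
  would start a nested arc, which ends before \<open>y\<close> and stays inside the segment, against
  transversality.\<close>

lemma less_iff_seg_less:
  assumes P: "P \<in> transversal_nct n lam mu" and xy: "x \<in> A" "y \<in> A" "Suc (level P x) = level P y"
  shows "x < y \<longleftrightarrow> seg mu x < seg mu y"
proof -
  interpret finite_partition A P using transversal_partition [OF P] .
  have dec: "seg mu (prev P z) < seg mu z" if "z \<in> A" "0 < level P z" for z
    using P that unfolding transversal_iff by blast
  have "\<not> (x < y \<and> seg mu x = seg mu y)"
  proof
    assume eq: "x < y \<and> seg mu x = seg mu y"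
    have pos: "0 < level P y" using xy(3) by simp
    have "\<not> x \<le> prev P y"
      using seg_mono [of x "prev P y" mu] prev_in [OF xy(2) pos] dec [OF xy(2) pos] eq weight by auto
    moreover have nc: "nc_matching A (level P) (prev P)" using P unfolding transversal_iff by blast
    ultimately obtain z where z: "z \<in> A" "0 < level P z" "prev P z = x" "z < y"
      using nc_matchingD [OF nc xy(2,1,3)] eq by auto
    then show False using dec [OF z(1,2)] seg_mono [of z y mu] eq xy weight by simp
  qed
  then show ?thesis
    using seg_mono [of x y mu] seg_mono [of y x mu] xy weight by (cases x y rule: linorder_cases) auto
qed

lemma tableau_of_transversal:
  assumes "P \<in> transversal_nct n lam mu"
  shows "tableau (level P) \<in> semistandard_tableaux lam mu"
proof (rule tableau_semistandard)
  interpret finite_partition A P using transversal_partition [OF assms] .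
  show "levelled (level P)" using assms by (simp add: transversal_iff)
  show "inj_on (prev P) {x \<in> A. 0 < level P x}" by (rule inj_on_prev)
  show "prev P x \<in> A \<and> Suc (level P (prev P x)) = level P x \<and> seg mu (prev P x) < seg mu x"
    if "x \<in> A" "0 < level P x" for x
    using assms that prev_in [OF that] level_prev [OF that] unfolding transversal_iff by blast
qed

text \<open>The elements of a block lie in different segments, and \<open>\<pi>\<close> preserves
  segments, so it is increasing on each block and preserves levels. Hence \<open>P\<close> and
  \<open>Q\<close> have equally many elements of each level with segment at most \<open>j\<close>,
  and these numbers determine the tableau.\<close>

lemma tableau_eq_if_equiv:
  assumes "(P, Q) \<in> segment_equiv n lam mu"
  shows "tableau (level P) = tableau (level Q)"
proof -
  obtain \<pi> where P: "P \<in> transversal_nct n lam mu" and Q: "Q \<in> transversal_nct n lam mu"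
    and \<pi>: "\<pi> \<in> segment_young_subgroup mu" and QP: "Q = (\<lambda>a. \<pi> ` a) ` P"
    using assms by (auto simp: segment_equiv_def)
  interpret P: finite_partition A P using transversal_partition [OF P] .
  interpret Q: finite_partition A Q using transversal_partition [OF Q] .
  have perm: "\<pi> permutes A" using \<pi> weight by (simp add: segment_young_subgroup_def)
  have img: "\<pi> ` A = A" using perm by (rule permutes_image)
  have inj: "inj \<pi>" using perm by (rule permutes_inj)
  have seg: "seg mu (\<pi> x) = seg mu x" if x: "x \<in> A" for x
  proof -
    have i: "seg mu x \<in> {1..length mu}" using seg_range x weight by simp
    then have "x \<in> segment mu (seg mu x)" using mem_segment_iff [of x mu] x weight by simp
    then have "\<pi> x \<in> segment mu (seg mu x)"
      using \<pi> i unfolding segment_young_subgroup_def by blast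
    moreover have "\<pi> x \<in> A" using img x by blast
    ultimately show ?thesis using mem_segment_iff [of "\<pi> x" mu "seg mu x"] i weight by simp
  qed
  have less: "\<pi> y < \<pi> x" if "x \<in> A" "y \<in> A" "block P y = block P x" "y < x" for x y
  proof -
    have pos: "0 < level P x" and le: "y \<le> prev P x" using P.le_prev that by auto
    have "seg mu y \<le> seg mu (prev P x)"
      using seg_mono [OF le] P.prev_in [OF that(1) pos] weight by simp
    also have "\<dots> < seg mu x" using P that(1) pos unfolding transversal_iff by blast
    finally have "\<not> seg mu (\<pi> x) \<le> seg mu (\<pi> y)" using seg that by simp
    moreover have "\<pi> y \<le> sum_list mu" using img that(2) weight by auto
    ultimately show ?thesis using seg_mono [of "\<pi> x" "\<pi> y" mu] by force
  qed
  have level: "level Q (\<pi> x) = level P x" if x: "x \<in> A" for x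
  proof -
    have "block Q (\<pi> x) = \<pi> ` block P x"
      using P.block_in [OF x] P.mem_block [OF x] QP by (intro Q.block_eq) auto
    moreover have "{y \<in> \<pi> ` block P x. y < \<pi> x} = \<pi> ` {y \<in> block P x. y < x}"
    proof -
      have "\<pi> y < \<pi> x \<longleftrightarrow> y < x" if "y \<in> block P x" for y
        using less [of x y] less [of y x] that x P.mem_block_iff [OF x, of y]
        by (cases x y rule: linorder_cases) auto
      then show ?thesis by auto
    qed
    ultimately show ?thesis
      using card_image [OF inj_on_subset [OF inj subset_UNIV]] by (simp add: level_def rank_def)
  qed
  have "card {x \<in> A. level P x = r \<and> seg mu x \<le> j} = card {x \<in> A. level Q x = r \<and> seg mu x \<le> j}" for r j
  proof -
    have "{x \<in> A. level Q x = r \<and> seg mu x \<le> j} = {x \<in> \<pi> ` A. level Q x = r \<and> seg mu x \<le> j}"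
      by (simp only: img)
    also have "\<dots> = \<pi> ` {x \<in> A. level P x = r \<and> seg mu x \<le> j}"
      unfolding Compr_image_eq by (simp add: level seg cong: conj_cong)
    finally show ?thesis by (simp only: card_image [OF inj_on_subset [OF inj subset_UNIV]])
  qed
  then have "tableau (level P) (r, c) \<le> j \<longleftrightarrow> tableau (level Q) (r, c) \<le> j"
    if "(r, c) \<in> young_diagram lam" for r c j
    using P Q tableau_le_iff [OF _ that] by (simp only: transversal_iff)
  then have "tableau (level P) (r, c) = tableau (level Q) (r, c)"
    if "(r, c) \<in> young_diagram lam" for r c
    using that by (meson order_antisym order_refl)
  then show ?thesis by (auto simp: tableau_def fun_eq_iff restrict_def)
qed

text \<open>Let \<open>\<pi>\<close> match the elements in the same cell. It preserves segments,
  levels, the order within a level and, as this is decided by segments, the order between adjacent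
  levels. So it carries \<open>prev P\<close> to a non-crossing matching for the levels of
  \<open>Q\<close>, which is \<open>prev Q\<close> by uniqueness; hence it maps blocks to
  blocks.\<close>

lemma equiv_if_tableau_eq:
  assumes P: "P \<in> transversal_nct n lam mu" and Q: "Q \<in> transversal_nct n lam mu"
    and eq: "tableau (level P) = tableau (level Q)"
  shows "(P, Q) \<in> segment_equiv n lam mu"
proof -
  interpret P: finite_partition A P using transversal_partition [OF P] .
  interpret Q: finite_partition A Q using transversal_partition [OF Q] .
  have lP: "levelled (level P)" and lQ: "levelled (level Q)"
    using P Q by (simp_all add: transversal_iff)
  have ncP: "nc_matching A (level P) (prev P)" and ncQ: "nc_matching A (level Q) (prev Q)"
    using P Q unfolding transversal_iff by blast+
  \<comment> \<open>Outside \<open>A\<close> the map is the identity, as \<open>permutes\<close>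
    demands.\<close>
  define \<pi> where "\<pi> x = (if x \<in> A then inv_into A (cell (level Q)) (cell (level P) x) else x)" for x
  have bP: "bij_betw (cell (level P)) A (young_diagram lam)"
    and bQ: "bij_betw (cell (level Q)) A (young_diagram lam)"
    using bij_betw_cell lP lQ by blast+
  have bij: "bij_betw \<pi> A A"
    using bij_betw_trans [OF bP bij_betw_inv_into [OF bQ]]
    by (rule bij_betw_cong [THEN iffD1, rotated]) (simp add: \<pi>_def)
  have inj: "inj_on \<pi> A" and img: "\<pi> ` A = A" using bij by (simp_all add: bij_betw_def)
  have \<pi>A: "\<pi> x \<in> A" if "x \<in> A" for x using img that by blast
  have cell: "cell (level Q) (\<pi> x) = cell (level P) x" if "x \<in> A" for x
    using bij_betw_inv_into_right [OF bQ] bP that unfolding \<pi>_def by (simp add: bij_betwE)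
  have seg: "seg mu (\<pi> x) = seg mu x" if "x \<in> A" for x
    using tableau_cell [OF lP that] tableau_cell [OF lQ \<pi>A [OF that]] cell [OF that] eq by simp
  have level: "level Q (\<pi> x) = level P x" if "x \<in> A" for x
    using cell [OF that] by (simp add: cell_def)
  have same_row: "\<pi> x < \<pi> y \<longleftrightarrow> x < y" if xy: "x \<in> A" "y \<in> A" "level P x = level P y" for x y
  proof -
    have "rank {z \<in> A. level Q z = level P y} (\<pi> z) = rank {z \<in> A. level P z = level P y} z"
      if "z \<in> A" "level P z = level P y" for z
      using cell [OF that(1)] level [OF that(1)] that(2) by (simp add: cell_def)
    note rank = this [OF xy(1,3)] this [OF xy(2) refl]
    have "\<pi> x < \<pi> y \<longleftrightarrow> rank {z \<in> A. level Q z = level P y} (\<pi> x) < rank {z \<in> A. level Q z = level P y} (\<pi> y)"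
      using xy \<pi>A level by (intro rank_less_iff [symmetric]) auto
    also have "\<dots> \<longleftrightarrow> x < y"
      unfolding rank using xy by (intro rank_less_iff) auto
    finally show ?thesis .
  qed
  have next_row: "\<pi> x < \<pi> y \<longleftrightarrow> x < y" if "x \<in> A" "y \<in> A" "Suc (level P x) = level P y" for x y
    using less_iff_seg_less [OF P that] less_iff_seg_less [OF Q \<pi>A \<pi>A, of x y] seg level that by simp
  \<comment> \<open>These are the arcs of \<open>P\<close> transported by
    \<open>\<pi>\<close>.\<close>
  define h where "h y = \<pi> (prev P (inv_into A \<pi> y))" for y
  have h: "h (\<pi> x) = \<pi> (prev P x)" if "x \<in> A" for x
    using that inj by (simp add: h_def)
  have "nc_matching (\<pi> ` A) (level Q) h"
    unfolding nc_matching_def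
  proof (intro conjI ballI impI)
    fix y assume "y \<in> \<pi> ` A" "0 < level Q y"
    then obtain x where x: "x \<in> A" "y = \<pi> x" "0 < level P x" using level by auto
    note p = P.prev_in [OF x(1,3)] P.level_prev [OF x(1,3)] P.prev_less [OF x(1,3)]
    show "h y \<in> \<pi> ` A" "Suc (level Q (h y)) = level Q y" "h y < y"
      using x p h level next_row [of "prev P x" x] by simp_all
  next
    show "inj_on h {x \<in> \<pi> ` A. 0 < level Q x}"
    proof (rule inj_onI)
      fix y z assume "y \<in> {x \<in> \<pi> ` A. 0 < level Q x}" "z \<in> {x \<in> \<pi> ` A. 0 < level Q x}" and yz: "h y = h z"
      then obtain u v where u: "u \<in> A" "y = \<pi> u" "0 < level P u" and v: "v \<in> A" "z = \<pi> v" "0 < level P v"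
        using level by auto
      have "\<pi> (prev P u) = \<pi> (prev P v)" using yz u v h by simp
      then have "prev P u = prev P v"
        using inj_onD [OF inj] P.prev_in [OF u(1,3)] P.prev_in [OF v(1,3)] by blast
      then show "y = z" using inj_onD [OF P.inj_on_prev, of u v] u v by simp
    qed
  next
    fix y z assume "y \<in> \<pi> ` A" "z \<in> \<pi> ` A" and yz: "Suc (level Q z) = level Q y \<and> h y < z \<and> z < y"
    then obtain u v where u: "u \<in> A" "y = \<pi> u" and v: "v \<in> A" "z = \<pi> v" by blast
    have lev: "Suc (level P v) = level P u" using yz u v level by simp
    then have pos: "0 < level P u" by simp
    have "prev P u < v"
      using same_row [of "prev P u" v] P.prev_in [OF u(1) pos] P.level_prev [OF u(1) pos] yz u v lev h by simp
    moreover have "v < u" using next_row [OF v(1) u(1) lev] yz u v by simp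
    ultimately obtain w where w: "w \<in> A" "0 < level P w" "prev P w = v" "w < u"
      using nc_matchingD [OF ncP u(1) v(1) lev] by blast
    have "level P w = level P u" using P.level_prev [OF w(1,2)] w(3) lev by simp
    then have "\<pi> w < y" using same_row [OF w(1) u(1)] w u by simp
    then show "\<exists>x\<in>\<pi> ` A. 0 < level Q x \<and> h x = z \<and> x < y"
      using w h level v by (intro bexI [of _ "\<pi> w"]) simp_all
  qed
  then have nch: "nc_matching A (level Q) h" by (simp only: img)
  have prev: "prev Q (\<pi> x) = \<pi> (prev P x)" if "x \<in> A" "0 < level P x" for x
    using nc_matching_unique [OF ncQ nch, of "\<pi> x"] \<pi>A level h that by simp
  \<comment> \<open>The bound on \<open>l\<close> ensures that \<open>prev\<close> is never applied
    at level 0, where it is junk.\<close>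
  have root: "(prev Q ^^ l) (\<pi> x) = \<pi> ((prev P ^^ l) x) \<and> (prev P ^^ l) x \<in> A" if "x \<in> A" "l \<le> level P x" for x l
    using that
  proof (induction l arbitrary: x)
    case (Suc l)
    then have pos: "0 < level P x" by simp
    have "l \<le> level P (prev P x)" using P.level_prev [OF Suc.prems(1) pos] Suc.prems(2) by simp
    then show ?case
      using Suc.IH [OF P.prev_in [OF Suc.prems(1) pos]] prev [OF Suc.prems(1) pos]
      by (simp add: funpow_Suc_right del: funpow.simps)
  qed simp
  have same_block: "block Q (\<pi> x) = block Q (\<pi> y) \<longleftrightarrow> block P x = block P y" if "x \<in> A" "y \<in> A" for x y
  proof -
    have "block Q (\<pi> x) = block Q (\<pi> y) \<longleftrightarrow> \<pi> ((prev P ^^ level P x) x) = \<pi> ((prev P ^^ level P y) y)"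
      using Q.block_eq_iff_root [OF \<pi>A \<pi>A, OF that] root that level by simp
    also have "\<dots> \<longleftrightarrow> (prev P ^^ level P x) x = (prev P ^^ level P y) y"
      using inj_on_eq_iff [OF inj] root that by simp
    finally show ?thesis using P.block_eq_iff_root [OF that] by simp
  qed
  have block: "block Q (\<pi> x) = \<pi> ` block P x" if x: "x \<in> A" for x
  proof -
    have "block Q (\<pi> x) = {y \<in> \<pi> ` A. block Q y = block Q (\<pi> x)}"
      using Q.mem_block_iff [OF \<pi>A [OF x]] img by auto
    also have "\<dots> = \<pi> ` {y \<in> A. block P y = block P x}"
      unfolding Compr_image_eq using same_block x by (simp cong: conj_cong)
    also have "{y \<in> A. block P y = block P x} = block P x"
      using P.mem_block_iff [OF x] by auto
    finally show ?thesis .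
  qed
  have "Q = block Q ` \<pi> ` A" using Q.partition_eq_blocks by (simp only: img)
  also have "\<dots> = (\<lambda>a. \<pi> ` a) ` block P ` A"
    unfolding image_image using block by (rule image_cong [OF refl])
  also have "block P ` A = P" using P.partition_eq_blocks by (rule sym)
  finally have "Q = (\<lambda>a. \<pi> ` a) ` P" .
  moreover have "\<pi> \<in> segment_young_subgroup mu"
  proof -
    have "\<pi> permutes A" by (rule bij_imp_permutes [OF bij]) (simp only: \<pi>_def if_False)
    \<comment> \<open>Preservation of \<open>seg\<close> gives one inclusion; equality follows
      because the segment is finite and \<open>\<pi>\<close> is injective on it.\<close>
    moreover have "\<pi> ` segment mu i = segment mu i" if i: "i \<in> {1..length mu}" for i
    proof (rule card_subset_eq)
      have sub: "segment mu i \<subseteq> A" using segment_subset [of mu i] weight by simp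
      show "finite (segment mu i)" using sub finite_subset by blast
      show "\<pi> ` segment mu i \<subseteq> segment mu i"
      proof (rule image_subsetI)
        fix x assume x: "x \<in> segment mu i"
        then have "x \<in> A" using sub by blast
        then show "\<pi> x \<in> segment mu i"
          using x mem_segment_iff [of x mu i] mem_segment_iff [of "\<pi> x" mu i] seg [of x] \<pi>A [of x] i weight
          by simp
      qed
      show "card (\<pi> ` segment mu i) = card (segment mu i)"
        using card_image [OF inj_on_subset [OF inj sub]] .
    qed
    ultimately show ?thesis using weight by (simp add: segment_young_subgroup_def)
  qed
  ultimately show ?thesis using P Q unfolding segment_equiv_def by blast
qed

(* Standardization: cells are numbered by increasing entry, and among cells of equal
   entry the lower rows come first, so that arcs never stay inside a segment. *)
lemma ex_transversal:
  assumes T: "T \<in> semistandard_tableaux lam mu"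
  obtains P where "P \<in> transversal_nct n lam mu" "tableau (level P) = T"
proof -
  let ?D = "young_diagram lam"
  have ext: "T \<in> ?D \<rightarrow>\<^sub>E {1..length mu}"
    and row_step: "\<And>r c. (r, c) \<in> ?D \<Longrightarrow> (r, Suc c) \<in> ?D \<Longrightarrow> T (r, c) \<le> T (r, Suc c)"
    and col_step: "\<And>r c. (r, c) \<in> ?D \<Longrightarrow> (Suc r, c) \<in> ?D \<Longrightarrow> T (r, c) < T (Suc r, c)"
    and content: "\<And>i. i \<in> {1..length mu} \<Longrightarrow> card {p \<in> ?D. T p = i} = mu ! (i - 1)"
    using T by (simp_all add: semistandard_tableaux_def)
  have row: "T (r, c) \<le> T (r, c + d)" if "(r, c + d) \<in> ?D" for r c d
    using that
  proof (induction d)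
    case (Suc d)
    then show ?case using row_step [of r "c + d"] by (simp add: mem_young_diagram_iff)
  qed simp
  \<comment> \<open>Keys are compared lexicographically. The sign in \<open>- int r\<close> reverses
    the order of the rows; the column makes keys distinct and orders equal entries of a row from
    left to right.\<close>
  define key where "key = (\<lambda>(r, c). (T (r, c), - int r, c))"
  define num where "num p = Suc (rank (key ` ?D) (key p))" for p
  have inj_key: "inj_on key ?D" by (rule inj_onI) (auto simp: key_def)
  have fin: "finite (key ` ?D)" using finite_young_diagram by simp
  have num_less: "num p < num q \<longleftrightarrow> key p < key q" if "p \<in> ?D" "q \<in> ?D" for p q
    using that rank_less_iff [OF fin, of "key p" "key q"] by (simp add: num_def)
  have bij: "bij_betw num ?D A"
  proof -
    have "bij_betw key ?D (key ` ?D)" using inj_key by (rule inj_on_imp_bij_betw)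
    from bij_betw_trans [OF this bij_betw_rank [OF fin]]
    have "bij_betw (rank (key ` ?D) \<circ> key) ?D {..<n}"
      by (simp add: card_image [OF inj_key] card_young_diagram)
    moreover have "bij_betw Suc {..<n} A"
      by (simp add: bij_betw_def image_Suc_lessThan)
    ultimately have "bij_betw (Suc \<circ> (rank (key ` ?D) \<circ> key)) ?D A" by (rule bij_betw_trans)
    then show ?thesis by (simp add: num_def comp_def bij_betw_def inj_on_def image_def)
  qed
  have inj: "inj_on num ?D" and img: "num ` ?D = A" using bij by (simp_all add: bij_betw_def)
  have num_A: "num p \<in> A" if "p \<in> ?D" for p using img that by blast
  define cl where "cl = inv_into ?D num"
  have cl: "cl (num p) = p" if "p \<in> ?D" for p using inj that by (simp add: cl_def)
  have cl_D: "cl x \<in> ?D" "num (cl x) = x" if "x \<in> A" for x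
    using that img unfolding cl_def by (metis inv_into_into, metis f_inv_into_f)
  have counts: "card {p \<in> ?D. T p \<le> j} = sum_list (take j mu)" if "j \<le> length mu" for j
    using that
  proof (induction j)
    case 0
    have "{p \<in> ?D. T p \<le> 0} = {}" using ext by (fastforce simp: PiE_iff)
    then show ?case by (simp only: card.empty take0 sum_list.Nil)
  next
    case (Suc j)
    have "{p \<in> ?D. T p \<le> Suc j} = {p \<in> ?D. T p \<le> j} \<union> {p \<in> ?D. T p = Suc j}" by auto
    moreover have "card ({p \<in> ?D. T p \<le> j} \<union> {p \<in> ?D. T p = Suc j})
        = card {p \<in> ?D. T p \<le> j} + card {p \<in> ?D. T p = Suc j}"
      using finite_young_diagram by (intro card_Un_disjoint) auto
    moreover have "card {p \<in> ?D. T p = Suc j} = mu ! j" using content [of "Suc j"] Suc.prems by simp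
    ultimately show ?case using Suc by (simp add: take_Suc_conv_app_nth)
  qed
  have rank_key: "rank (key ` ?D) (key p) = card {q \<in> ?D. key q < key p}" for p
    unfolding rank_def Compr_image_eq using inj_on_subset [OF inj_key, of "{q \<in> ?D. key q < key p}"]
    by (simp add: card_image subset_eq)
  \<comment> \<open>All cells with smaller entries are numbered before \<open>p\<close>, and only
    cells with entries at most \<open>T p\<close> are. By \<open>counts\<close>, this places
    \<open>num p\<close> between the two prefix sums that bound segment \<open>T p\<close>.\<close>
  have seg_num: "seg mu (num p) = T p" if p: "p \<in> ?D" for p
  proof -
    have i: "1 \<le> T p" "T p \<le> length mu" using ext p by (auto simp: PiE_iff)
    have "num p \<le> sum_list mu" using num_A [OF p] weight by simp
    moreover have "num p \<le> sum_list (take (T p) mu)"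
    proof -
      have "{q \<in> ?D. key q < key p} \<subset> {q \<in> ?D. T q \<le> T p}"
        using p by (auto simp: key_def split: prod.splits)
      then have "rank (key ` ?D) (key p) < card {q \<in> ?D. T q \<le> T p}"
        unfolding rank_key using finite_young_diagram by (intro psubset_card_mono) simp_all
      then show ?thesis using counts [OF i(2)] by (simp add: num_def)
    qed
    moreover have "\<not> num p \<le> sum_list (take (T p - 1) mu)"
    proof -
      have "{q \<in> ?D. T q \<le> T p - 1} \<subseteq> {q \<in> ?D. key q < key p}"
        using i by (auto simp: key_def split: prod.splits)
      then have "card {q \<in> ?D. T q \<le> T p - 1} \<le> rank (key ` ?D) (key p)"
        unfolding rank_key using finite_young_diagram by (intro card_mono) simp_all
      then show ?thesis using counts [of "T p - 1"] i by (simp add: num_def)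
    qed
    ultimately show ?thesis
      using seg_le_iff [of "num p" mu "T p"] seg_le_iff [of "num p" mu "T p - 1"] by simp
  qed
  define lev where "lev x = fst (cl x)" for x
  have lev_num: "lev (num (r, c)) = r" if "(r, c) \<in> ?D" for r c using cl [OF that] by (simp add: lev_def)
  have obt: "\<exists>r c. (r, c) \<in> ?D \<and> x = num (r, c)" if "x \<in> A" for x
    using img that by (metis imageE prod.collapse)
  have row_less: "num (r, c) < num (r, c') \<longleftrightarrow> c < c'" if "(r, c) \<in> ?D" "(r, c') \<in> ?D" for r c c'
  proof -
    have lt: "num (r, a) < num (r, b)" if "a < b" "(r, a) \<in> ?D" "(r, b) \<in> ?D" for a b
      using row [of r a "b - a"] that num_less by (auto simp: key_def)
    show ?thesis using lt [of c c'] lt [of c' c] that by (cases c c' rule: linorder_cases) auto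
  qed
  have row_set: "{x \<in> A. lev x = r} = (\<lambda>c. num (r, c)) ` {..<row_length lam r}" for r
  proof (intro equalityI subsetI)
    fix x assume "x \<in> {x \<in> A. lev x = r}"
    then obtain r' c where rc: "(r', c) \<in> ?D" "x = num (r', c)" and "lev x = r" using obt by blast
    then have "r' = r" using lev_num [OF rc(1)] by simp
    with rc have "(r, c) \<in> ?D" "x = num (r, c)" by simp_all
    then show "x \<in> (\<lambda>c. num (r, c)) ` {..<row_length lam r}" by (simp add: mem_young_diagram_iff)
  next
    fix x assume "x \<in> (\<lambda>c. num (r, c)) ` {..<row_length lam r}"
    then obtain c where "(r, c) \<in> ?D" "x = num (r, c)" by (auto simp: mem_young_diagram_iff)
    then show "x \<in> {x \<in> A. lev x = r}" using num_A lev_num by simp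
  qed
  have inj_row: "inj_on (\<lambda>c. num (r, c)) {..<row_length lam r}" for r
  proof (rule inj_onI)
    fix c c' assume "c \<in> {..<row_length lam r}" "c' \<in> {..<row_length lam r}" "num (r, c) = num (r, c')"
    then show "c = c'"
      using inj_onD [OF inj, of "(r, c)" "(r, c')"] by (simp add: mem_young_diagram_iff)
  qed
  have lev: "levelled lev"
    unfolding levelled_def row_set using card_image [OF inj_row] by simp
  have cell_num: "cell lev (num (r, c)) = (r, c)" if rc: "(r, c) \<in> ?D" for r c
  proof -
    have "{y \<in> (\<lambda>c. num (r, c)) ` {..<row_length lam r}. y < num (r, c)} = (\<lambda>c. num (r, c)) ` {..<c}"
      using rc row_less [OF _ rc] by (auto simp: mem_young_diagram_iff)
    moreover have "inj_on (\<lambda>c. num (r, c)) {..<c}"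
      using inj_row [of r] by (rule inj_on_subset) (use rc in \<open>auto simp: mem_young_diagram_iff\<close>)
    ultimately show ?thesis
      unfolding cell_def rank_def lev_num [OF rc] row_set by (simp add: card_image)
  qed
  \<comment> \<open>This leads from a cell to the one directly above; \<open>r - 1\<close> matters
    only below the top row. By column strictness it goes to the left, so it is the injection from
    which a matching is obtained.\<close>
  define f where "f x = (case cl x of (r, c) \<Rightarrow> num (r - 1, c))" for x
  have f_num: "f (num (Suc r, c)) = num (r, c)" if "(Suc r, c) \<in> ?D" for r c
    using cl [OF that] by (simp add: f_def)
  have above: "(r, c) \<in> ?D" if "(Suc r, c) \<in> ?D" for r c
    using that row_length_antimono [of r "Suc r"] by (simp add: mem_young_diagram_iff)
  have obt_Suc: "\<exists>r c. (Suc r, c) \<in> ?D \<and> x = num (Suc r, c)" if "x \<in> A" "0 < lev x" for x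
    using obt [OF that(1)] lev_num that(2) by (metis gr0_conv_Suc)
  have "inj_on f {x \<in> A. 0 < lev x}"
  proof (rule inj_onI)
    fix x y assume "x \<in> {x \<in> A. 0 < lev x}" "y \<in> {x \<in> A. 0 < lev x}" and eq: "f x = f y"
    then obtain r c r' c' where x: "(Suc r, c) \<in> ?D" "x = num (Suc r, c)"
      and y: "(Suc r', c') \<in> ?D" "y = num (Suc r', c')" using obt_Suc by blast
    have "num (r, c) = num (r', c')" using eq x y f_num by simp
    then have "(r, c) = (r', c')" using inj_onD [OF inj] above x(1) y(1) by blast
    then show "x = y" using x y by simp
  qed
  moreover have "f x \<in> A \<and> Suc (lev (f x)) = lev x \<and> f x < x" if x: "x \<in> A" "0 < lev x" for x
  proof -
    obtain r c where rc: "(Suc r, c) \<in> ?D" "x = num (Suc r, c)" using obt_Suc x by blast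
    have "key (r, c) < key (Suc r, c)" using col_step above rc(1) by (auto simp: key_def)
    then show ?thesis
      using rc above [OF rc(1)] f_num [OF rc(1)] num_A lev_num num_less [of "(r, c)" "(Suc r, c)"] by simp
  qed
  \<comment> \<open>The matching respects the levels but may join cells of different
    columns.\<close>
  ultimately obtain g where g: "nc_matching A lev g"
    using ex_nc_matching [of A f lev] by blast
  then obtain P where P: "partition_on A P" "\<And>x. x \<in> A \<Longrightarrow> level P x = lev x"
      "\<And>x. x \<in> A \<Longrightarrow> 0 < lev x \<Longrightarrow> prev P x = g x"
    using partition_of_matching [of A lev g] by blast
  interpret finite_partition A P using P(1) by unfold_locales simp_all
  have levelP: "levelled (level P)"
  proof -
    have "{x \<in> A. level P x = i} = {x \<in> A. lev x = i}" for i using P(2) by (auto cong: conj_cong)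
    then show ?thesis using lev unfolding levelled_def by simp
  qed
  have nc: "nc_matching A (level P) (prev P)"
    unfolding nc_matching_def
  proof (intro conjI ballI impI)
    show "inj_on (prev P) {x \<in> A. 0 < level P x}" by (rule inj_on_prev)
    fix x y assume xy: "x \<in> A" "y \<in> A" "Suc (level P y) = level P x \<and> prev P x < y \<and> y < x"
    then have l: "Suc (lev y) = lev x" "0 < lev x" using P(2) [of x] P(2) [of y] by simp_all
    then obtain z where z: "z \<in> A" "0 < lev z" "g z = y" "z < x"
      using nc_matchingD [OF g xy(1,2) l(1)] xy(3) P(3) [OF xy(1) l(2)] by auto
    then show "\<exists>z\<in>A. 0 < level P z \<and> prev P z = y \<and> z < x" using P by (intro bexI [of _ z]) simp_all
  qed (use prev_in level_prev prev_less in blast)+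
  \<comment> \<open>Since \<open>prev P x\<close> need not come from the cell above that of
    \<open>x\<close>, column strictness does not apply directly. But \<open>prev P x\<close> lies
    one row higher and has a smaller number; with equal entries the lower row would have been
    numbered first.\<close>
  have dec: "seg mu (prev P x) < seg mu x" if x: "x \<in> A" "0 < level P x" for x
  proof -
    have p: "prev P x \<in> A" "prev P x < x" "Suc (lev (prev P x)) = lev x"
      using prev_in [OF x] prev_less [OF x] level_prev [OF x] P(2) x by auto
    obtain r c r' c' where rc: "(r, c) \<in> ?D" "x = num (r, c)"
      and rc': "(r', c') \<in> ?D" "prev P x = num (r', c')" using obt p(1) x(1) by metis
    have "Suc r' = r" using p(3) rc rc' lev_num by simp
    moreover have "key (r', c') < key (r, c)" using num_less [OF rc'(1) rc(1)] p(2) rc rc' by simp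
    ultimately have "T (r', c') < T (r, c)" by (auto simp: key_def)
    then show ?thesis using seg_num rc rc' by simp
  qed
  have "P \<in> transversal_nct n lam mu"
    unfolding transversal_iff using P(1) levelP nc dec by blast
  moreover have "tableau (level P) = T"
  proof
    fix p show "tableau (level P) p = T p"
    proof (cases "p \<in> ?D")
      case True
      obtain r c where rc: "p = (r, c)" by (cases p)
      have x: "num p \<in> A" using num_A [OF True] .
      have "{y \<in> A. level P y = k} = {y \<in> A. lev y = k}" for k using P(2) by (auto cong: conj_cong)
      then have "cell (level P) (num p) = cell lev (num p)" using P(2) [OF x] by (simp add: cell_def)
      then have "cell (level P) (num p) = p" using cell_num True rc by simp
      then show ?thesis using tableau_cell [OF levelP x] seg_num [OF True] by simp
    next
      case False
      then show ?thesis using PiE_arb [OF ext False] by (simp add: tableau_def)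
    qed
  qed
  ultimately show ?thesis by (rule that)
qed

text \<open>The equivalence is the kernel of the map sending \<open>P\<close> to
  \<open>tableau (level P)\<close>, and this map is onto the semistandard tableaux.\<close>

lemma card_semistandard_tableaux:
  "card (semistandard_tableaux lam mu) = card (semi_noncrossing_tableaux n lam mu)"
proof -
  let ?X = "transversal_nct n lam mu"
  have "(P, Q) \<in> segment_equiv n lam mu \<longleftrightarrow>
      P \<in> ?X \<and> Q \<in> ?X \<and> tableau (level P) = tableau (level Q)" for P Q
  proof
    assume PQ: "(P, Q) \<in> segment_equiv n lam mu"
    then have "P \<in> ?X \<and> Q \<in> ?X" by (simp add: segment_equiv_def)
    with tableau_eq_if_equiv [OF PQ] show "P \<in> ?X \<and> Q \<in> ?X \<and> tableau (level P) = tableau (level Q)"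
      by simp
  next
    assume "P \<in> ?X \<and> Q \<in> ?X \<and> tableau (level P) = tableau (level Q)"
    then show "(P, Q) \<in> segment_equiv n lam mu" using equiv_if_tableau_eq by simp
  qed
  then have "card (?X // segment_equiv n lam mu) = card ((\<lambda>P. tableau (level P)) ` ?X)"
    by (rule card_quotient_kernel)
  also have "(\<lambda>P. tableau (level P)) ` ?X = semistandard_tableaux lam mu"
  proof (intro equalityI subsetI)
    fix T assume "T \<in> semistandard_tableaux lam mu"
    then obtain P where "P \<in> ?X" "tableau (level P) = T" by (rule ex_transversal)
    then show "T \<in> (\<lambda>P. tableau (level P)) ` ?X" by blast
  qed (use tableau_of_transversal in blast)
  finally show ?thesis by (simp add: semi_noncrossing_tableaux_def)
qed

end

theorem theorem13:
  fixes n :: nat and lam mu :: "nat list"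
  assumes "is_partition_of lam n" and "sum_list mu = n"
  shows "card (semistandard_tableaux lam mu) = card (semi_noncrossing_tableaux n lam mu)"
proof -
  interpret shape_weight n lam mu using assms by unfold_locales
  show ?thesis by (rule card_semistandard_tableaux)
qed

end
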